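(* Let $k_1 > k_2 \geq 2$ be integers and let $G$ be an infinite graph such that every vertex of $G$ has degree either $k_1$ or $k_2$. Suppose further that every vertex of degree $k_1$ is adjacent only to vertices of degree $k_2$, and every vertex of degree $k_2$ is adjacent only to vertices of degree $k_1$. Then non-backtracking random walk is recurrent on $G$ if and only if simple random walk is recurrent on $G$.
   Context: Graphs are undirected and simple; $x\sim y$ means that $x$ and $y$ are adjacent, and $\deg(x)$ is the number of neighbours of $x$. Simple random walk on $G$ is the Markov chain on the vertices of $G$ which from a vertex $x$ moves to each neighbour of $x$ with probability $1/\deg(x)$. Non-backtracking random walk on $G$ is the random process $(X_n)_{n\ge 0}$ on the vertices of $G$ with transition probabilities $P(X_1=y\mid X_0=x)=\frac{1}{\deg(x)}$ if $y\sim x$ and $0$ otherwise, and, for $n\ge 1$, conditionally on the past up to time $n$ with $X_{n-1}=x_1$ and $X_n=x_2$, $P(X_{n+1}=y\mid X_n=x_2, X_{n-1}=x_1)=\frac{1}{\deg(x_2)-1}$ if $y\sim x_2$ and $y\ne x_1$, and $0$ if $y\not\sim x_2$ or $y=x_1$. A walk (simple or non-backtracking) is recurrent on $G$ if, for every starting vertex $v$, the walk started at $X_0=v$ almost surely visits $v$ infinitely often. *)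

theory Defs
  imports "HOL-Probability.Probability"
begin

definition simple_graph :: "'a set \<Rightarrow> ('a \<Rightarrow> 'a \<Rightarrow> bool) \<Rightarrow> bool" where
  "simple_graph V adj \<longleftrightarrow>
     (\<forall>x y. adj x y \<longrightarrow> x \<in> V \<and> y \<in> V) \<and>
     (\<forall>x y. adj x y \<longrightarrow> adj y x) \<and>
     (\<forall>x. \<not> adj x x)"

text \<open>As \<^const>\<open>card\<close> is 0 on infinite sets, a vertex of positive degree has finitely many
  neighbours.\<close>

definition deg :: "('a \<Rightarrow> 'a \<Rightarrow> bool) \<Rightarrow> 'a \<Rightarrow> nat" where
  "deg adj x = card {y. adj x y}"

text \<open>A one-step transition rule \<open>p\<close> gives the probability \<open>p n x y\<close> of moving to \<open>y\<close> at time
  \<open>Suc n\<close> when the trajectory up to time \<open>n\<close> is \<open>x 0, \<dots>, x n\<close>; later entries of \<open>x\<close> are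
  irrelevant.\<close>

definition srw_step :: "('a \<Rightarrow> 'a \<Rightarrow> bool) \<Rightarrow> nat \<Rightarrow> (nat \<Rightarrow> 'a) \<Rightarrow> 'a \<Rightarrow> real" where
  "srw_step adj n x y = (if adj (x n) y then 1 / real (deg adj (x n)) else 0)"

definition nbrw_step :: "('a \<Rightarrow> 'a \<Rightarrow> bool) \<Rightarrow> nat \<Rightarrow> (nat \<Rightarrow> 'a) \<Rightarrow> 'a \<Rightarrow> real" where
  "nbrw_step adj n x y =
     (if n = 0 then (if adj (x 0) y then 1 / real (deg adj (x 0)) else 0)
      else (if adj (x n) y \<and> y \<noteq> x (n - 1) then 1 / (real (deg adj (x n)) - 1) else 0))"

definition walk_process ::
  "(nat \<Rightarrow> (nat \<Rightarrow> 'a) \<Rightarrow> 'a \<Rightarrow> real) \<Rightarrow> 'a \<Rightarrow> 'w measure \<Rightarrow> (nat \<Rightarrow> 'w \<Rightarrow> 'a) \<Rightarrow> bool" where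
  "walk_process p v M X \<longleftrightarrow>
     prob_space M \<and>
     (\<forall>n. X n \<in> measurable M (count_space UNIV)) \<and>
     (AE \<omega> in M. X 0 \<omega> = v) \<and>
     (\<forall>n x y. \<P>(\<omega> in M. \<forall>i\<le>n. X i \<omega> = x i) > 0 \<longrightarrow>
        \<P>(\<omega> in M. X (Suc n) \<omega> = y \<bar> \<forall>i\<le>n. X i \<omega> = x i) = p n x y)"

text \<open>Recurrence depends only on the law of the walk, so the sample space may be taken to be of
  the type \<^typ>\<open>nat \<Rightarrow> 'a\<close> of trajectories. The lemmas \<open>srw_exists\<close> and \<open>nbrw_exists\<close> below
  show that the quantification over processes is not vacuous.\<close>

definition recurrent_walk ::
  "'a set \<Rightarrow> (nat \<Rightarrow> (nat \<Rightarrow> 'a) \<Rightarrow> 'a \<Rightarrow> real) \<Rightarrow> bool" where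
  "recurrent_walk V p \<longleftrightarrow>
     (\<forall>v\<in>V. \<forall>(M :: (nat \<Rightarrow> 'a) measure) X. walk_process p v M X \<longrightarrow>
        (AE \<omega> in M. infinite {n. X n \<omega> = v}))"

definition srw_recurrent :: "'a set \<Rightarrow> ('a \<Rightarrow> 'a \<Rightarrow> bool) \<Rightarrow> bool" where
  "srw_recurrent V adj \<longleftrightarrow> recurrent_walk V (srw_step adj)"

definition nbrw_recurrent :: "'a set \<Rightarrow> ('a \<Rightarrow> 'a \<Rightarrow> bool) \<Rightarrow> bool" where
  "nbrw_recurrent V adj \<longleftrightarrow> recurrent_walk V (nbrw_step adj)"


text \<open>Existence of the walks: each finite trajectory \<open>h\<close> gets an independent choice \<open>\<omega> h\<close> of the
  next vertex.\<close>

primrec hist :: "'a \<Rightarrow> nat \<Rightarrow> ('a list \<Rightarrow> 'a) \<Rightarrow> 'a list" where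
  "hist v 0 \<omega> = [v]"
| "hist v (Suc n) \<omega> = hist v n \<omega> @ [\<omega> (hist v n \<omega>)]"

lemma length_hist [simp]: "length (hist v n \<omega>) = Suc n"
  by (induction n) auto

lemma hist_eq_map: "hist v n \<omega> = map (\<lambda>i. last (hist v i \<omega>)) [0..<Suc n]"
proof (induction n)
  case (Suc n)
  have "map (\<lambda>i. last (hist v i \<omega>)) [0..<Suc (Suc n)] =
      map (\<lambda>i. last (hist v i \<omega>)) [0..<Suc n] @ [last (hist v (Suc n) \<omega>)]"
    by simp
  also have "\<dots> = hist v n \<omega> @ [last (hist v (Suc n) \<omega>)]"
    by (simp only: Suc.IH [symmetric])
  finally show ?case by simp
qed simp

lemma hist_eq_iff:
  "hist v n \<omega> = map x [0..<Suc n] \<longleftrightarrow> (\<forall>i\<le>n. last (hist v i \<omega>) = x i)"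
  by (subst hist_eq_map) (auto simp del: upt_Suc simp: less_Suc_eq_le)

lemma hist_eq_iff_choices:
  "hist v n \<omega> = map x [0..<Suc n] \<longleftrightarrow>
     x 0 = v \<and> (\<forall>i<n. \<omega> (map x [0..<Suc i]) = x (Suc i))"
proof (induction n)
  case 0
  show ?case by auto
next
  case (Suc n)
  have "hist v (Suc n) \<omega> = map x [0..<Suc (Suc n)] \<longleftrightarrow>
      hist v n \<omega> = map x [0..<Suc n] \<and> \<omega> (map x [0..<Suc n]) = x (Suc n)"
    by auto
  also have "\<dots> \<longleftrightarrow> x 0 = v \<and> (\<forall>i<Suc n. \<omega> (map x [0..<Suc i]) = x (Suc i))"
    unfolding Suc.IH less_Suc_eq by blast
  finally show ?case .
qed

lemma kernel_process_exists:
  fixes q :: "'a list \<Rightarrow> 'a pmf"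
  obtains M :: "(nat \<Rightarrow> 'a) measure" and X where
    "prob_space M" "\<And>n. X n \<in> measurable M (count_space UNIV)" "AE \<omega> in M. X 0 \<omega> = v"
    "\<And>n x. \<P>(\<omega> in M. \<forall>i\<le>Suc n. X i \<omega> = x i) =
       \<P>(\<omega> in M. \<forall>i\<le>n. X i \<omega> = x i) * pmf (q (map x [0..<Suc n])) (x (Suc n))"
proof -
  define N where "N h = restrict_space (measure_pmf (q h)) (set_pmf (q h))" for h
  have spN: "space (N h) = set_pmf (q h)" for h
    by (simp add: N_def space_restrict_space)
  have seN: "sets (N h) = Pow (set_pmf (q h))" for h
    by (auto simp: N_def sets_restrict_space)
  have pN: "prob_space (N h)" for h
    unfolding N_def
    by (rule prob_space_restrict_space)
       (auto intro!: measure_pmf.emeasure_eq_1_AE simp: AE_measure_pmf_iff)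
  have mN: "measure (N h) ({y} \<inter> set_pmf (q h)) = pmf (q h) y" for h y
  proof -
    have "measure (N h) ({y} \<inter> set_pmf (q h)) =
        measure (measure_pmf (q h)) ({y} \<inter> set_pmf (q h))"
      unfolding N_def by (subst measure_restrict_space) auto
    also have "\<dots> = pmf (q h) y"
      by (simp add: measure_Int_set_pmf pmf.rep_eq)
    finally show ?thesis .
  qed
  define \<Omega> where "\<Omega> = PiM (UNIV :: 'a list set) N"
  interpret product_prob_space N UNIV
    by (simp add: product_prob_space_def product_prob_space_axioms_def
        product_sigma_finite_def pN prob_space_imp_sigma_finite)
  have prob\<Omega>: "prob_space \<Omega>"
    unfolding \<Omega>_def by (rule prob_space_PiM) (rule pN)
  have sp\<Omega>: "\<omega> \<in> space \<Omega> \<longleftrightarrow> (\<forall>h. \<omega> h \<in> set_pmf (q h))" for \<omega>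
    by (auto simp: \<Omega>_def space_PiM PiE_iff spN)
  have cyl: "{\<omega> \<in> space \<Omega>. \<forall>i<n. \<omega> (map x [0..<Suc i]) = x (Suc i)} \<in> sets \<Omega> \<and>
      measure \<Omega> {\<omega> \<in> space \<Omega>. \<forall>i<n. \<omega> (map x [0..<Suc i]) = x (Suc i)} =
        (\<Prod>i<n. pmf (q (map x [0..<Suc i])) (x (Suc i)))" for x :: "nat \<Rightarrow> 'a" and n
  proof -
    define J where "J = (\<lambda>i. map x [0..<Suc i]) ` {..<n}"
    define E where "E h = {x (length h)} \<inter> set_pmf (q h)" for h
    have inj: "inj_on (\<lambda>i. map x [0..<Suc i]) {..<n}"
      by (rule inj_onI) (drule arg_cong[where f = length], simp)
    have eq: "{\<omega> \<in> space \<Omega>. \<forall>i<n. \<omega> (map x [0..<Suc i]) = x (Suc i)} =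
        prod_emb UNIV N J (Pi\<^sub>E J E)"
    proof (rule set_eqI)
      fix \<omega>
      have "\<omega> \<in> prod_emb UNIV N J (Pi\<^sub>E J E) \<longleftrightarrow> \<omega> \<in> space \<Omega> \<and> (\<forall>h\<in>J. \<omega> h \<in> E h)"
        by (auto simp: prod_emb_def \<Omega>_def space_PiM PiE_iff)
      also have "\<dots> \<longleftrightarrow> \<omega> \<in> space \<Omega> \<and> (\<forall>i<n. \<omega> (map x [0..<Suc i]) = x (Suc i))"
        unfolding J_def E_def sp\<Omega> by (simp del: upt_Suc) blast
      finally show "\<omega> \<in> {\<omega> \<in> space \<Omega>. \<forall>i<n. \<omega> (map x [0..<Suc i]) = x (Suc i)} \<longleftrightarrow>
          \<omega> \<in> prod_emb UNIV N J (Pi\<^sub>E J E)" by simp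
    qed
    have E: "E h \<in> sets (N h)" for h
      by (auto simp: E_def seN)
    have "measure \<Omega> (prod_emb UNIV N J (Pi\<^sub>E J E)) = (\<Prod>h\<in>J. measure (N h) (E h))"
      unfolding \<Omega>_def by (rule measure_PiM_emb) (auto simp: E J_def)
    also have "\<dots> = (\<Prod>i<n. pmf (q (map x [0..<Suc i])) (x (Suc i)))"
      unfolding J_def
      by (subst prod.reindex[OF inj]) (auto simp: E_def mN simp del: upt_Suc intro!: prod.cong)
    finally have m: "measure \<Omega> (prod_emb UNIV N J (Pi\<^sub>E J E)) =
        (\<Prod>i<n. pmf (q (map x [0..<Suc i])) (x (Suc i)))" .
    have "prod_emb UNIV N J (Pi\<^sub>E J E) \<in> sets \<Omega>"
      unfolding \<Omega>_def by (rule sets_PiM_I) (auto simp: E J_def)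
    with m show ?thesis unfolding eq by simp
  qed
  have H: "{\<omega> \<in> space \<Omega>. hist v n \<omega> = map x [0..<Suc n]} \<in> sets \<Omega> \<and>
      measure \<Omega> {\<omega> \<in> space \<Omega>. hist v n \<omega> = map x [0..<Suc n]} =
       (if x 0 = v then (\<Prod>i<n. pmf (q (map x [0..<Suc i])) (x (Suc i))) else 0)" for x n
  proof (cases "x 0 = v")
    case True
    with cyl[of n x] show ?thesis unfolding hist_eq_iff_choices by (simp only: simp_thms if_True)
  next
    case False
    then show ?thesis unfolding hist_eq_iff_choices by simp
  qed
  define L where "L n = hist v n ` space \<Omega>" for n
  have cL: "countable (L n)" for n
  proof (induction n)
    case 0
    have "L 0 \<subseteq> {[v]}" by (auto simp: L_def)
    then show ?case by (rule countable_subset) simp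
  next
    case (Suc n)
    have "L (Suc n) \<subseteq> (\<Union>h\<in>L n. (\<lambda>y. h @ [y]) ` set_pmf (q h))"
    proof
      fix h assume "h \<in> L (Suc n)"
      then obtain \<omega> where \<omega>: "\<omega> \<in> space \<Omega>" "h = hist v n \<omega> @ [\<omega> (hist v n \<omega>)]"
        by (auto simp: L_def)
      then have "hist v n \<omega> \<in> L n" "\<omega> (hist v n \<omega>) \<in> set_pmf (q (hist v n \<omega>))"
        by (simp_all add: L_def sp\<Omega>)
      with \<omega>(2) show "h \<in> (\<Union>h\<in>L n. (\<lambda>y. h @ [y]) ` set_pmf (q h))" by blast
    qed
    moreover have "countable (\<Union>h\<in>L n. (\<lambda>y. h @ [y]) ` set_pmf (q h))"
      using Suc by auto
    ultimately show ?case by (rule countable_subset)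
  qed
  have mh: "hist v n \<in> measurable \<Omega> (count_space (L n))" for n
  proof (subst measurable_count_space_eq_countable[OF cL], intro conjI ballI)
    show "hist v n \<in> space \<Omega> \<rightarrow> L n" by (auto simp: L_def)
    fix h assume "h \<in> L n"
    then have "length h = Suc n" by (auto simp: L_def)
    then have "h = map (nth h) [0..<Suc n]" by (metis map_nth)
    then have "hist v n -` {h} \<inter> space \<Omega> =
        {\<omega> \<in> space \<Omega>. hist v n \<omega> = map (nth h) [0..<Suc n]}" by auto
    then show "hist v n -` {h} \<inter> space \<Omega> \<in> sets \<Omega>" using H[of n "nth h"] by simp
  qed
  define P where "P = PiM (UNIV :: nat set) (\<lambda>_. count_space (UNIV :: 'a set))"
  define T where "T \<omega> n = last (hist v n \<omega>)" for \<omega> n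
  have mT1: "(\<lambda>\<omega>. T \<omega> n) \<in> measurable \<Omega> (count_space UNIV)" for n
    unfolding T_def by (rule measurable_compose[OF mh]) simp
  have mT: "T \<in> measurable \<Omega> P"
    unfolding P_def by (rule measurable_PiM_single'[of UNIV "\<lambda>n \<omega>. T \<omega> n", simplified])
      (auto intro: mT1)
  define M where "M = distr \<Omega> P T"
  define X where "X n \<omega> = \<omega> n" for n and \<omega> :: "nat \<Rightarrow> 'a"
  have mX: "X n \<in> measurable P (count_space UNIV)" for n
    unfolding X_def P_def by (rule measurable_component_singleton) simp
  have setP: "{\<omega> \<in> space P. \<forall>i\<le>n. X i \<omega> = x i} \<in> sets P" for n x
  proof -
    have [measurable]: "X i \<in> measurable P (count_space UNIV)" for i by (rule mX)
    show ?thesis by measurable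
  qed
  have spP: "space P = UNIV" by (auto simp: P_def space_PiM)
  have PM: "\<P>(\<omega> in M. \<forall>i\<le>n. X i \<omega> = x i) =
      (if x 0 = v then (\<Prod>i<n. pmf (q (map x [0..<Suc i])) (x (Suc i))) else 0)" for n x
  proof -
    have "\<P>(\<omega> in M. \<forall>i\<le>n. X i \<omega> = x i) =
        measure \<Omega> (T -` {\<omega> \<in> space P. \<forall>i\<le>n. X i \<omega> = x i} \<inter> space \<Omega>)"
      unfolding M_def space_distr by (rule measure_distr[OF mT setP])
    also have "T -` {\<omega> \<in> space P. \<forall>i\<le>n. X i \<omega> = x i} \<inter> space \<Omega> =
        {\<omega> \<in> space \<Omega>. hist v n \<omega> = map x [0..<Suc n]}"
      unfolding hist_eq_iff by (auto simp: spP X_def T_def)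
    finally show ?thesis using H[of n x] by simp
  qed
  show thesis
  proof (rule that[of M X])
    show "prob_space M" unfolding M_def by (rule prob_space.prob_space_distr[OF prob\<Omega> mT])
    show "X n \<in> measurable M (count_space UNIV)" for n unfolding M_def using mX by simp
    show "AE \<omega> in M. X 0 \<omega> = v"
    proof -
      have "{\<omega> \<in> space P. X 0 \<omega> = v} \<in> sets P" using setP[of 0 "\<lambda>_. v"] by simp
      then show ?thesis
        unfolding M_def by (subst AE_distr_iff[OF mT]) (auto simp: T_def X_def)
    qed
    show "\<P>(\<omega> in M. \<forall>i\<le>Suc n. X i \<omega> = x i) =
        \<P>(\<omega> in M. \<forall>i\<le>n. X i \<omega> = x i) * pmf (q (map x [0..<Suc n])) (x (Suc n))" for n x
      unfolding PM by simp
  qed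
qed

lemma walk_process_exists:
  fixes p :: "nat \<Rightarrow> (nat \<Rightarrow> 'a) \<Rightarrow> 'a \<Rightarrow> real"
  assumes cong: "\<And>n x x' y. (\<And>i. i \<le> n \<Longrightarrow> x i = x' i) \<Longrightarrow> p n x y = p n x' y"
    and distr: "\<And>n x. x 0 = v \<Longrightarrow> (\<And>i. i < n \<Longrightarrow> p i x (x (Suc i)) > 0) \<Longrightarrow>
      \<exists>r. \<forall>y. pmf r y = p n x y"
  shows "\<exists>(M :: (nat \<Rightarrow> 'a) measure) X. walk_process p v M X"
proof -
  define q where "q h = (SOME r. \<forall>y. pmf r y = p (length h - 1) (nth h) y)" for h
  have q: "pmf (q (map x [0..<Suc n])) y = p n x y"
    if "\<exists>r. \<forall>y. pmf r y = p n x y" for n x y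
  proof -
    have "p n (nth (map x [0..<Suc n])) y = p n x y" for y
      by (rule cong) (simp del: upt_Suc)
    then have "q (map x [0..<Suc n]) = (SOME r. \<forall>y. pmf r y = p n x y)"
      by (simp add: q_def del: upt_Suc)
    then show ?thesis using someI_ex[OF that] by simp
  qed
  obtain M :: "(nat \<Rightarrow> 'a) measure" and X where
    M: "prob_space M" and X: "\<And>n. X n \<in> measurable M (count_space UNIV)"
    and X0: "AE \<omega> in M. X 0 \<omega> = v"
    and st: "\<And>n x. \<P>(\<omega> in M. \<forall>i\<le>Suc n. X i \<omega> = x i) =
       \<P>(\<omega> in M. \<forall>i\<le>n. X i \<omega> = x i) * pmf (q (map x [0..<Suc n])) (x (Suc n))"
    by (rule kernel_process_exists[of v q]) blast
  have pos: "x 0 = v \<and> (\<forall>i<n. p i x (x (Suc i)) > 0)"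
    if "\<P>(\<omega> in M. \<forall>i\<le>n. X i \<omega> = x i) > 0" for n x
    using that
  proof (induction n)
    case 0
    have "x 0 = v"
    proof (rule ccontr)
      assume "x 0 \<noteq> v"
      then have "AE \<omega> in M. \<not> (\<forall>i\<le>0. X i \<omega> = x i)" by (intro eventually_mono[OF X0]) auto
      moreover have "{\<omega> \<in> space M. \<forall>i\<le>0. X i \<omega> = x i} = X 0 -` {x 0} \<inter> space M"
        by auto
      then have "{\<omega> \<in> space M. \<forall>i\<le>0. X i \<omega> = x i} \<in> sets M"
        using measurable_sets[OF X, of "{x 0}" 0] by simp
      ultimately have "\<P>(\<omega> in M. \<forall>i\<le>0. X i \<omega> = x i) = 0"
        by (auto simp: prob_space.prob_eq_0[OF M])
      with 0 show False by simp
    qed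
    then show ?case by simp
  next
    case (Suc n)
    have "\<P>(\<omega> in M. \<forall>i\<le>n. X i \<omega> = x i) > 0"
      and *: "pmf (q (map x [0..<Suc n])) (x (Suc n)) > 0"
      using Suc.prems unfolding st by (auto simp: zero_less_mult_iff simp del: upt_Suc)
    then have IH: "x 0 = v \<and> (\<forall>i<n. p i x (x (Suc i)) > 0)" using Suc.IH by blast
    then have "\<exists>r. \<forall>y. pmf r y = p n x y" using distr[of x n] by blast
    with * have "p n x (x (Suc n)) > 0" using q[of n x] by simp
    with IH show ?case by (auto simp: less_Suc_eq)
  qed
  have "\<P>(\<omega> in M. X (Suc n) \<omega> = y \<bar> \<forall>i\<le>n. X i \<omega> = x i) = p n x y"
    if *: "\<P>(\<omega> in M. \<forall>i\<le>n. X i \<omega> = x i) > 0" for n x y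
  proof -
    let ?x = "x(Suc n := y)"
    have m: "map ?x [0..<Suc n] = map x [0..<Suc n]" by auto
    have "(X (Suc n) \<omega> = y \<and> (\<forall>i\<le>n. X i \<omega> = x i)) \<longleftrightarrow> (\<forall>i\<le>Suc n. X i \<omega> = ?x i)" for \<omega>
      by (auto simp: le_Suc_eq)
    then have "\<P>(\<omega> in M. X (Suc n) \<omega> = y \<and> (\<forall>i\<le>n. X i \<omega> = x i)) =
        \<P>(\<omega> in M. \<forall>i\<le>Suc n. X i \<omega> = ?x i)"
      by (simp only:)
    also have "\<dots> = \<P>(\<omega> in M. \<forall>i\<le>n. X i \<omega> = x i) * pmf (q (map x [0..<Suc n])) y"
      unfolding st m by simp
    also have "pmf (q (map x [0..<Suc n])) y = p n x y"
      using pos[OF *] distr[of x n] q[of n x y] by blast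
    finally show ?thesis using * by (simp add: cond_prob_def)
  qed
  with M X X0 show ?thesis unfolding walk_process_def by blast
qed

lemma srw_exists:
  fixes V :: "'a set"
  assumes G: "simple_graph V adj" and deg: "\<And>x. x \<in> V \<Longrightarrow> deg adj x \<ge> 1" and v: "v \<in> V"
  shows "\<exists>(M :: (nat \<Rightarrow> 'a) measure) X. walk_process (srw_step adj) v M X"
proof (rule walk_process_exists)
  fix n x assume x: "x 0 = v" "\<And>i. i < n \<Longrightarrow> srw_step adj i x (x (Suc i)) > 0"
  have "x n \<in> V"
  proof (cases n)
    case (Suc m)
    then have "adj (x m) (x n)" using x(2)[of m] by (auto simp: srw_step_def split: if_splits)
    then show ?thesis using G by (auto simp: simple_graph_def)
  qed (use x v in simp)
  then have "card {y. adj (x n) y} \<ge> 1" using deg by (simp add: deg_def)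
  then have "finite {y. adj (x n) y}" "{y. adj (x n) y} \<noteq> {}"
    by (auto intro: card_ge_0_finite simp del: Collect_empty_eq)
  then have "\<forall>y. pmf (pmf_of_set {y. adj (x n) y}) y = srw_step adj n x y"
    by (auto simp: srw_step_def deg_def indicator_def)
  then show "\<exists>r. \<forall>y. pmf r y = srw_step adj n x y" by blast
qed (auto simp: srw_step_def)

lemma nbrw_exists:
  fixes V :: "'a set"
  assumes G: "simple_graph V adj" and deg: "\<And>x. x \<in> V \<Longrightarrow> deg adj x \<ge> 2" and v: "v \<in> V"
  shows "\<exists>(M :: (nat \<Rightarrow> 'a) measure) X. walk_process (nbrw_step adj) v M X"
proof (rule walk_process_exists)
  fix n x assume x: "x 0 = v" "\<And>i. i < n \<Longrightarrow> nbrw_step adj i x (x (Suc i)) > 0"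
  show "\<exists>r. \<forall>y. pmf r y = nbrw_step adj n x y"
  proof (cases n)
    case 0
    have "card {y. adj v y} \<ge> 2" using deg[OF v] by (simp add: deg_def)
    then have "finite {y. adj v y}" "{y. adj v y} \<noteq> {}"
      by (auto intro: card_ge_0_finite simp del: Collect_empty_eq)
    then have "\<forall>y. pmf (pmf_of_set {y. adj v y}) y = nbrw_step adj n x y"
      using x(1) 0 by (auto simp: nbrw_step_def deg_def indicator_def)
    then show ?thesis by blast
  next
    case (Suc m)
    then have "adj (x m) (x n)" using x(2)[of m] by (auto simp: nbrw_step_def split: if_splits)
    then have V: "x n \<in> V" and a: "adj (x n) (x m)" using G by (auto simp: simple_graph_def)
    let ?S = "{y. adj (x n) y} - {x m}"
    have c: "card {y. adj (x n) y} \<ge> 2" using deg[OF V] by (simp add: deg_def)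
    then have fin: "finite {y. adj (x n) y}" by (auto intro: card_ge_0_finite)
    then have S: "card ?S = deg adj (x n) - 1" using a by (simp add: deg_def)
    with c have "?S \<noteq> {}" by (metis card.empty deg_def diff_is_0_eq not_less_eq_eq numeral_2_eq_2 One_nat_def)
    moreover have "real (deg adj (x n) - 1) = real (deg adj (x n)) - 1"
      using c by (simp add: deg_def of_nat_diff)
    ultimately have "\<forall>y. pmf (pmf_of_set ?S) y = nbrw_step adj n x y"
      using fin Suc S by (auto simp: nbrw_step_def indicator_def)
    then show ?thesis by blast
  qed
qed (auto simp: nbrw_step_def)

end

theory Submission
  imports Defs
begin

text \<open>The non-backtracking walk is a Markov chain on directed edges whose reversal is conjugate to
  itself by edge reversal. Hence an edge that is visited infinitely often in expectation is
  recurrent together with its reversal, and either walk is recurrent at \<open>v\<close> iff its expected number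
  of visits to \<open>v\<close> is infinite. These expectations are compared by generating functions. With \<open>deg'\<close>
  the degree of the neighbours of a vertex, the numbers \<open>a n x = deg x * P\<^sub>x(X\<^sub>n = v)\<close> of the
  non-backtracking walk satisfy
  \<open>(deg' x - 1) * a (n + 2) x = (\<Sum>y \<sim> x. a (n + 1) y) - a n x\<close>, so \<open>\<Sum>n. r ^ n * a n x\<close>, up to a
  correction at \<open>v\<close>, is a Green function of the simple random walk. Eliminating the other class of
  the bipartition turns it into \<open>\<Sum>j. u ^ j * P\<^sub>v(S\<^sub>2\<^sub>j = v)\<close> for the simple walk \<open>S\<close>, where \<open>u < 1\<close> tends
  to 1 as \<open>r\<close> does.\<close>

subsection \<open>Uniform Markov kernels\<close>

text \<open>The transition operator of the chain that jumps from \<open>s\<close> to a uniform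
  element of \<open>N s\<close>: \<open>(avg N ^^ n) f s\<close> is the expectation of
  \<open>f\<close> after \<open>n\<close> steps.\<close>

definition avg :: "('s \<Rightarrow> 's set) \<Rightarrow> ('s \<Rightarrow> real) \<Rightarrow> 's \<Rightarrow> real" where
  "avg N f s = (\<Sum>t\<in>N s. f t) / card (N s)"

text \<open>Probability that the chain from \<open>s\<close> lies in the listed sets at successive
  times; the head of the list constrains the starting state itself.\<close>

primrec path_prob :: "('s \<Rightarrow> 's set) \<Rightarrow> 's set list \<Rightarrow> 's \<Rightarrow> real" where
  "path_prob N [] = (\<lambda>s. 1)"
| "path_prob N (B # Bs) = (\<lambda>s. indicat_real B s * avg N (path_prob N Bs) s)"

text \<open>No visit to \<open>S\<close> at the times \<open>1, \<dots>, n\<close>; the starting state may lie in \<open>S\<close>.\<close>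

definition avoid :: "('s \<Rightarrow> 's set) \<Rightarrow> 's set \<Rightarrow> nat \<Rightarrow> 's \<Rightarrow> real" where
  "avoid N S n = avg N (path_prob N (replicate n (- S)))"

abbreviation visit :: "('s \<Rightarrow> 's set) \<Rightarrow> 's set \<Rightarrow> nat \<Rightarrow> 's \<Rightarrow> real" where
  "visit N S n \<equiv> (avg N ^^ n) (indicat_real S)"

lemma avg_add: "avg N (\<lambda>t. f t + g t) s = avg N f s + avg N g s"
  by (simp add: avg_def sum.distrib add_divide_distrib)

lemma avg_diff: "avg N (\<lambda>t. f t - g t) s = avg N f s - avg N g s"
  by (simp add: avg_def sum_subtractf diff_divide_distrib)

lemma avg_cmult: "avg N (\<lambda>t. c * f t) s = c * avg N f s"
  by (simp add: avg_def sum_distrib_left)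

lemma avg_sum: "avg N (\<lambda>t. \<Sum>i\<in>A. f i t) s = (\<Sum>i\<in>A. avg N (f i) s)"
  unfolding avg_def by (subst sum.swap) (simp add: sum_divide_distrib)

lemma avg_cong: "(\<And>t. t \<in> N s \<Longrightarrow> f t = g t) \<Longrightarrow> avg N f s = avg N g s"
  by (simp add: avg_def)

lemma avg_mono: "(\<And>t. t \<in> N s \<Longrightarrow> f t \<le> g t) \<Longrightarrow> avg N f s \<le> avg N g s"
  by (simp add: avg_def sum_mono divide_right_mono)

lemma avg_nonneg: "(\<And>t. t \<in> N s \<Longrightarrow> 0 \<le> f t) \<Longrightarrow> 0 \<le> avg N f s"
  by (simp add: avg_def sum_nonneg)

lemma avg_tendsto_0:
  assumes "\<And>t. t \<in> N s \<Longrightarrow> (\<lambda>k. f k t) \<longlonglongrightarrow> 0"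
  shows "(\<lambda>k. avg N (f k) s) \<longlonglongrightarrow> 0"
  unfolding avg_def divide_inverse
  using assms by (intro tendsto_mult_left_zero tendsto_null_sum) auto

lemma avgpow_tendsto_0:
  assumes "\<And>s. (\<lambda>k. f k s) \<longlonglongrightarrow> 0"
  shows "(\<lambda>k. (avg N ^^ n) (f k) s) \<longlonglongrightarrow> 0"
proof (induction n arbitrary: s)
  case (Suc n)
  then show ?case by (simp add: avg_tendsto_0)
qed (simp add: assms)

lemma avgpow_cmult: "(avg N ^^ n) (\<lambda>t. c * f t) s = c * (avg N ^^ n) f s"
proof (induction n arbitrary: s)
  case (Suc n)
  then have "(avg N ^^ n) (\<lambda>t. c * f t) = (\<lambda>t. c * (avg N ^^ n) f t)" by blast
  then show ?case by (simp add: avg_cmult)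
qed simp

lemma avgpow_sum: "(avg N ^^ n) (\<lambda>t. \<Sum>i\<in>A. f i t) s = (\<Sum>i\<in>A. (avg N ^^ n) (f i) s)"
proof (induction n arbitrary: s)
  case (Suc n)
  then have "(avg N ^^ n) (\<lambda>t. \<Sum>i\<in>A. f i t) = (\<lambda>t. \<Sum>i\<in>A. (avg N ^^ n) (f i) t)" by blast
  then show ?case by (simp add: avg_sum)
qed simp

lemma avgpow_nonneg: "(\<And>t. 0 \<le> f t) \<Longrightarrow> 0 \<le> (avg N ^^ n) f s"
  by (induction n arbitrary: s) (auto intro: avg_nonneg)

lemma visit_nonneg: "0 \<le> visit N S n s"
  by (intro avgpow_nonneg) simp

lemma path_prob_nonneg: "0 \<le> path_prob N Bs s"
  by (induction Bs arbitrary: s) (simp_all add: avg_nonneg)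

lemma avoid_nonneg: "0 \<le> avoid N S n s"
  by (simp add: avoid_def avg_nonneg path_prob_nonneg)

lemma avoid_Suc: "avoid N S (Suc n) s = avg N (\<lambda>t. indicat_real (- S) t * avoid N S n t) s"
  by (simp add: avoid_def)

text \<open>The list encodes a visit to \<open>S\<close> at time \<open>n\<close> followed by
  \<open>k\<close> steps outside \<open>S\<close>, the event of a last visit as seen up to time
  \<open>n + k\<close>.\<close>

lemma path_prob_last_visit:
  "path_prob N (replicate n UNIV @ S # replicate k (- S)) =
   (avg N ^^ n) (\<lambda>s. indicat_real S s * avoid N S k s)"
  by (induction n) (simp_all add: avoid_def)

section \<open>Last exits, Green sums and time reversal\<close>

locale uniform_kernel =
  fixes N :: "'s \<Rightarrow> 's set"
  assumes finite_N [simp]: "finite (N s)" and N_nonempty [simp]: "N s \<noteq> {}"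
begin

lemma avg_const [simp]: "avg N (\<lambda>_. c) s = c"
  by (simp add: avg_def)

lemma avg_le: "(\<And>t. t \<in> N s \<Longrightarrow> f t \<le> c) \<Longrightarrow> avg N f s \<le> c"
  using avg_mono[of N s f "\<lambda>_. c"] by simp

lemma avgpow_abs_le:
  assumes "\<And>t. \<bar>f t\<bar> \<le> c"
  shows "\<bar>(avg N ^^ n) f s\<bar> \<le> c"
proof (induction n arbitrary: s)
  case (Suc n)
  have "avg N ((avg N ^^ n) f) s \<le> c"
    using Suc by (intro avg_le) (simp add: abs_le_iff)
  moreover have "- avg N ((avg N ^^ n) f) s \<le> c"
    using Suc avg_cmult[of N "-1" "(avg N ^^ n) f" s, symmetric]
    by (auto intro!: avg_le simp: abs_le_iff)
  ultimately show ?case by (simp add: abs_le_iff)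
qed (simp add: assms)

lemma visit_le_1: "visit N S n s \<le> 1"
proof -
  have "\<bar>visit N S n s\<bar> \<le> 1" by (rule avgpow_abs_le) (simp add: indicator_def)
  then show ?thesis by simp
qed

lemma avoid_0 [simp]: "avoid N S 0 s = 1"
  by (simp add: avoid_def)

lemma path_prob_UNIV_append: "path_prob N (replicate n UNIV @ [S]) = visit N S n"
  using path_prob_last_visit[of N n S 0] by simp

lemma avoid_le_1: "avoid N S n s \<le> 1"
proof (induction n arbitrary: s)
  case (Suc n)
  show ?case unfolding avoid_Suc
    using Suc by (intro avg_le) (auto simp: indicator_def)
qed simp

lemma avoid_antimono: "S \<subseteq> S' \<Longrightarrow> avoid N S' n s \<le> avoid N S n s"
proof (induction n arbitrary: s)
  case (Suc n)
  then show ?case unfolding avoid_Suc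
    by (intro avg_mono) (auto simp: indicator_def avoid_nonneg)
qed simp

lemma avoid_decseq: "decseq (\<lambda>n. avoid N S n s)"
proof (rule decseq_SucI)
  show "avoid N S (Suc n) s \<le> avoid N S n s" for n
  proof (induction n arbitrary: s)
    case 0
    show ?case by (simp only: avoid_0 avoid_le_1)
  next
    case (Suc n)
    show ?case
      by (subst (1 2) avoid_Suc) (intro avg_mono mult_left_mono Suc, simp)
  qed
qed

text \<open>The \<open>k\<close>-th summand is the probability that the last visit to \<open>S\<close> up to time \<open>n\<close> is at time \<open>k\<close>.\<close>

lemma last_exit:
  "(\<Sum>k\<le>n. (avg N ^^ k) (\<lambda>s. indicat_real S s * avoid N S (n - k) s) s) =
     1 - indicat_real (- S) s * avoid N S n s"
proof (induction n arbitrary: s)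
  case 0
  show ?case by (simp add: indicator_def)
next
  case (Suc n)
  have "(\<Sum>k\<le>Suc n. (avg N ^^ k) (\<lambda>s. indicat_real S s * avoid N S (Suc n - k) s) s) =
     indicat_real S s * avoid N S (Suc n) s +
     (\<Sum>k\<le>n. avg N ((avg N ^^ k) (\<lambda>s. indicat_real S s * avoid N S (n - k) s)) s)"
    by (subst sum.atMost_Suc_shift) simp
  also have "(\<Sum>k\<le>n. avg N ((avg N ^^ k) (\<lambda>s. indicat_real S s * avoid N S (n - k) s)) s) =
      avg N (\<lambda>t. 1 - indicat_real (- S) t * avoid N S n t) s"
    unfolding avg_sum[symmetric] Suc.IH ..
  also have "\<dots> = 1 - avoid N S (Suc n) s"
    by (simp add: avg_diff avoid_Suc)
  finally show ?case by (simp add: indicator_def)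
qed

text \<open>For a single state the escape probability after the last visit does not depend on where
  it takes place, so the decomposition becomes a convolution of visits and escapes.\<close>

lemma last_exit_singleton:
  "(\<Sum>k\<le>n. visit N {e} k s * avoid N {e} (n - k) e) =
     1 - indicat_real (- {e}) s * avoid N {e} n s"
proof -
  have "(\<lambda>s. indicat_real {e} s * avoid N {e} m s) =
      (\<lambda>s. avoid N {e} m e * indicat_real {e} s)" for m
    by (auto simp: indicator_def)
  then have "(avg N ^^ k) (\<lambda>s. indicat_real {e} s * avoid N {e} (n - k) s) s =
      visit N {e} k s * avoid N {e} (n - k) e" for k
    by (simp add: avgpow_cmult)
  then show ?thesis using last_exit[where S = "{e}" and n = n and s = s] by simp
qed

text \<open>Let \<open>L\<close> be the limit of the decreasing escape probabilities. If it were
  positive, the convolution, which is at most 1, would bound the expected number of visits by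
  \<open>1 / L\<close>. The start \<open>s\<close> may differ from \<open>e\<close>.\<close>

lemma avoid_tendsto_0_if_not_summable:
  assumes "\<not> summable (\<lambda>n. visit N {e} n s)"
  shows "(\<lambda>n. avoid N {e} n e) \<longlonglongrightarrow> 0"
proof -
  obtain L where L: "(\<lambda>n. avoid N {e} n e) \<longlonglongrightarrow> L" "\<And>n. L \<le> avoid N {e} n e"
    using decseq_convergent[OF avoid_decseq, where B = 0] avoid_nonneg by metis
  have "0 \<le> L" using L(1) by (rule LIMSEQ_le_const) (simp add: avoid_nonneg)
  moreover have "\<not> 0 < L"
  proof
    assume pos: "0 < L"
    have "(\<Sum>k\<le>n. visit N {e} k s) \<le> 1 / L" for n
    proof -
      have "L * (\<Sum>k\<le>n. visit N {e} k s) \<le> (\<Sum>k\<le>n. visit N {e} k s * avoid N {e} (n - k) e)"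
        unfolding sum_distrib_left
        using L(2) by (intro sum_mono) (simp add: mult.commute[of L] mult_left_mono visit_nonneg)
      also have "\<dots> \<le> 1" unfolding last_exit_singleton by (simp add: avoid_nonneg)
      finally show ?thesis using pos by (simp add: field_simps)
    qed
    then have "summable (\<lambda>n. visit N {e} n s)"
      by (intro bounded_imp_summable[where B = "1 / L"] visit_nonneg)
    with assms show False ..
  qed
  ultimately show ?thesis using L(1) by simp
qed

text \<open>With a finite expected number of visits, the last exit sum at time \<open>2 * m\<close>,
  which equals 1 from \<open>e\<close>, would tend to 0.\<close>

lemma not_summable_if_avoid_tendsto_0:
  assumes "(\<lambda>n. avoid N {e} n e) \<longlonglongrightarrow> 0"
  shows "\<not> summable (\<lambda>n. visit N {e} n e)"
proof
  assume s: "summable (\<lambda>n. visit N {e} n e)"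
  let ?a = "\<lambda>n. visit N {e} n e" and ?f = "\<lambda>n. avoid N {e} n e"
  let ?A = "\<lambda>m. \<Sum>k\<le>m. ?a k"
  \<comment> \<open>Last visits up to time \<open>m\<close> leave at least \<open>m\<close> steps to
    escape; later ones are bounded by the expected number of visits in
    \<open>{m<..2 * m}\<close>.\<close>
  have "1 \<le> ?f m * ?A m + (?A (2 * m) - ?A m)" for m
  proof -
    have "1 = (\<Sum>k\<le>2 * m. ?a k * ?f (2 * m - k))"
      by (simp add: last_exit_singleton)
    also have "\<dots> = (\<Sum>k\<le>m. ?a k * ?f (2 * m - k)) + (\<Sum>k\<in>{m<..2 * m}. ?a k * ?f (2 * m - k))"
      by (subst sum.union_disjoint[symmetric]) (auto intro!: sum.cong)
    also have "\<dots> \<le> (\<Sum>k\<le>m. ?a k * ?f m) + (\<Sum>k\<in>{m<..2 * m}. ?a k * 1)"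
      by (intro add_mono sum_mono mult_left_mono visit_nonneg avoid_le_1
          decseqD[OF avoid_decseq]) auto
    also have "(\<Sum>k\<in>{m<..2 * m}. ?a k * 1) = ?A (2 * m) - ?A m"
    proof -
      have "{..2 * m} = {..m} \<union> {m<..2 * m}" by auto
      then have "?A (2 * m) = ?A m + (\<Sum>k\<in>{m<..2 * m}. ?a k)"
        by (simp only:) (rule sum.union_disjoint, auto)
      then show ?thesis by simp
    qed
    finally show ?thesis by (simp add: sum_distrib_left mult.commute)
  qed
  moreover have "(\<lambda>m. ?f m * ?A m + (?A (2 * m) - ?A m)) \<longlonglongrightarrow> 0 * suminf ?a + (suminf ?a - suminf ?a)"
  proof (intro tendsto_intros assms)
    show A: "?A \<longlonglongrightarrow> suminf ?a" using s by (rule summable_LIMSEQ')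
    show "(\<lambda>m. ?A (2 * m)) \<longlonglongrightarrow> suminf ?a"
      using LIMSEQ_subseq_LIMSEQ[OF A, of "\<lambda>m. 2 * m"] by (simp add: strict_mono_def comp_def)
    show "?A \<longlonglongrightarrow> suminf ?a" by (rule A)
  qed
  ultimately have "1 \<le> 0 * suminf ?a + (suminf ?a - suminf ?a)"
    by (intro LIMSEQ_le_const) auto
  then show False by simp
qed

text \<open>The involution \<open>r\<close> turns a step from \<open>s\<close> to \<open>t\<close>
  into an equally likely step from \<open>r t\<close> to \<open>r s\<close>, so the first step of
  one path is the last step of the reversed one.\<close>

lemma visit_reversal:
  assumes inv: "\<And>s. r (r s) = s"
    and rev: "\<And>s t. t \<in> N s \<Longrightarrow> r s \<in> N (r t) \<and> card (N (r t)) = card (N s)"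
  shows "visit N {t} n s = visit N {r s} n (r t)"
proof (induction n arbitrary: s t)
  case 0
  show ?case using inv by (auto simp: indicator_def) metis+
next
  case (Suc n)
  \<comment> \<open>One-step probability of reaching \<open>r s\<close>: the states with
    \<open>r s\<close> as a successor are exactly the images under \<open>r\<close> of the
    successors of \<open>s\<close>.\<close>
  have step: "avg N (indicat_real {r s}) = (\<lambda>u. 1 / card (N s) * (\<Sum>v\<in>N s. indicat_real {r v} u))"
  proof
    fix u
    have "(\<Sum>v\<in>N s. indicat_real {r v} u) = (\<Sum>v\<in>N s. indicat_real {r u} v)"
      using inv by (intro sum.cong) (auto simp: indicator_def)
    then have 1: "(\<Sum>v\<in>N s. indicat_real {r v} u) = indicat_real (N s) (r u)"
      by (simp add: indicator_def)
    have 2: "(\<Sum>v\<in>N u. indicat_real {r s} v) = indicat_real (N u) (r s)"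
      by (simp add: indicator_def)
    have "r s \<in> N u \<longleftrightarrow> r u \<in> N s" using rev[of "r s" u] rev[of "r u" s] inv by auto
    moreover have "r s \<in> N u \<Longrightarrow> card (N u) = card (N s)" using rev[of "r s" u] inv by auto
    ultimately show "avg N (indicat_real {r s}) u =
        1 / card (N s) * (\<Sum>v\<in>N s. indicat_real {r v} u)"
      unfolding avg_def 1 2 by (auto simp: indicator_def)
  qed
  have "visit N {r s} (Suc n) (r t) = (avg N ^^ n) (avg N (indicat_real {r s})) (r t)"
    by (simp add: funpow_swap1)
  also have "\<dots> = 1 / card (N s) * (\<Sum>v\<in>N s. visit N {r v} n (r t))"
    unfolding step avgpow_cmult avgpow_sum ..
  also have "\<dots> = 1 / card (N s) * (\<Sum>v\<in>N s. visit N {t} n v)"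
    by (simp add: Suc.IH[of t])
  finally show ?case by (simp add: avg_def[of N _ s])
qed

end

section \<open>Processes with a uniform kernel\<close>

text \<open>Only singletons are assumed measurable: on an uncountable vertex set the pair
  \<open>(X n, X (Suc n))\<close> need not be measurable for the full power set.\<close>

locale uniform_chain = uniform_kernel N + prob_space M
  for N :: "'s \<Rightarrow> 's set" and M :: "'w measure" +
  fixes Y :: "nat \<Rightarrow> 'w \<Rightarrow> 's" and I :: "'s set"
  assumes meas [measurable]: "\<And>n s. {\<omega> \<in> space M. Y n \<omega> = s} \<in> sets M"
    and finite_I [simp]: "finite I" and I_nonempty [simp]: "I \<noteq> {}"
    and init: "\<And>s. s \<in> I \<Longrightarrow> \<P>(\<omega> in M. Y 0 \<omega> = s) = 1 / card I"
    and step: "\<And>n y t. t \<in> N (y n) \<Longrightarrow>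
      \<P>(\<omega> in M. (\<forall>i\<le>n. Y i \<omega> = y i) \<and> Y (Suc n) \<omega> = t) =
      \<P>(\<omega> in M. \<forall>i\<le>n. Y i \<omega> = y i) / card (N (y n))"
begin

text \<open>Total probability over the values of \<open>Y n\<close>. Hypothesis \<open>total\<close>
  says that the values in \<open>F\<close> carry the whole mass of \<open>P\<close>; hence
  \<open>Y n\<close> lies in \<open>F\<close> almost surely on \<open>P\<close>, and only singleton
  events enter.\<close>

lemma prob_split:
  assumes [measurable]: "{\<omega> \<in> space M. P \<omega>} \<in> sets M" "{\<omega> \<in> space M. Q \<omega>} \<in> sets M"
    and F: "finite F" and total: "\<P>(\<omega> in M. P \<omega>) = (\<Sum>t\<in>F. \<P>(\<omega> in M. P \<omega> \<and> Y n \<omega> = t))"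
  shows "\<P>(\<omega> in M. P \<omega> \<and> Q \<omega>) = (\<Sum>t\<in>F. \<P>(\<omega> in M. P \<omega> \<and> Y n \<omega> = t \<and> Q \<omega>))"
proof -
  have U: "\<P>(\<omega> in M. P \<omega> \<and> Y n \<omega> \<in> F \<and> R \<omega>) = (\<Sum>t\<in>F. \<P>(\<omega> in M. P \<omega> \<and> Y n \<omega> = t \<and> R \<omega>))"
    if [measurable]: "{\<omega> \<in> space M. R \<omega>} \<in> sets M" for R
  proof -
    have "{\<omega> \<in> space M. P \<omega> \<and> Y n \<omega> \<in> F \<and> R \<omega>} = (\<Union>t\<in>F. {\<omega> \<in> space M. P \<omega> \<and> Y n \<omega> = t \<and> R \<omega>})"
      by auto
    moreover have "disjoint_family_on (\<lambda>t. {\<omega> \<in> space M. P \<omega> \<and> Y n \<omega> = t \<and> R \<omega>}) F"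
      by (auto simp: disjoint_family_on_def)
    ultimately show ?thesis
      using F by (simp add: finite_measure_finite_Union image_subset_iff)
  qed
  have mF [measurable]: "{\<omega> \<in> space M. Y n \<omega> \<in> F} \<in> sets M"
  proof -
    have "{\<omega> \<in> space M. Y n \<omega> \<in> F} = (\<Union>t\<in>F. {\<omega> \<in> space M. Y n \<omega> = t})" by auto
    also have "\<dots> \<in> sets M" using F by (intro sets.finite_UN) auto
    finally show ?thesis .
  qed
  have "\<P>(\<omega> in M. P \<omega>) = \<P>(\<omega> in M. P \<omega> \<and> Y n \<omega> \<in> F)"
    using U[of "\<lambda>_. True"] total by simp
  then have "AE \<omega> in M. P \<omega> \<longrightarrow> Y n \<omega> \<in> F"
  proof -
    assume eq: "\<P>(\<omega> in M. P \<omega>) = \<P>(\<omega> in M. P \<omega> \<and> Y n \<omega> \<in> F)"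
    have "\<P>(\<omega> in M. P \<omega>) = \<P>(\<omega> in M. P \<omega> \<and> Y n \<omega> \<in> F) + \<P>(\<omega> in M. P \<omega> \<and> Y n \<omega> \<notin> F)"
      by (subst finite_measure_Union[symmetric]) (auto intro!: arg_cong[where f = prob])
    with eq have "\<P>(\<omega> in M. P \<omega> \<and> Y n \<omega> \<notin> F) = 0" by simp
    then have "AE \<omega> in M. \<not> (P \<omega> \<and> Y n \<omega> \<notin> F)" by (subst (asm) prob_eq_0) auto
    then show ?thesis by eventually_elim auto
  qed
  then have "\<P>(\<omega> in M. P \<omega> \<and> Q \<omega>) = \<P>(\<omega> in M. P \<omega> \<and> Y n \<omega> \<in> F \<and> Q \<omega>)"
    by (intro finite_measure_eq_AE) (auto elim!: eventually_mono)
  then show ?thesis using U[of Q] by simp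
qed

text \<open>The Markov property, proved by fixing one more state of the history for each set in the
  list. The first set refers to time \<open>n\<close>, the last time of the history.\<close>

lemma prob_history_path:
  assumes "\<And>B n. B \<in> set Bs \<Longrightarrow> {\<omega> \<in> space M. Y n \<omega> \<in> B} \<in> sets M"
  shows "\<P>(\<omega> in M. (\<forall>i\<le>n. Y i \<omega> = y i) \<and> (\<forall>j<length Bs. Y (n + j) \<omega> \<in> Bs ! j)) =
    \<P>(\<omega> in M. \<forall>i\<le>n. Y i \<omega> = y i) * path_prob N Bs (y n)"
  using assms
proof (induction Bs arbitrary: n y)
  case Nil
  show ?case by simp
next
  case (Cons B Bs)
  have split: "(\<forall>j<length (B # Bs). Y (n + j) \<omega> \<in> (B # Bs) ! j) \<longleftrightarrow>
      Y n \<omega> \<in> B \<and> (\<forall>j<length Bs. Y (Suc n + j) \<omega> \<in> Bs ! j)" for \<omega>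
    by (auto simp: nth_Cons less_Suc_eq_0_disj split: nat.splits)
  show ?case
  proof (cases "y n \<in> B")
    case False
    then have "{\<omega> \<in> space M. (\<forall>i\<le>n. Y i \<omega> = y i) \<and> (\<forall>j<length (B # Bs). Y (n + j) \<omega> \<in> (B # Bs) ! j)} = {}"
      unfolding split by auto
    with False show ?thesis by (simp only:) (simp add: indicator_def)
  next
    case True
    let ?H = "\<lambda>\<omega>. \<forall>i\<le>n. Y i \<omega> = y i" and ?Q = "\<lambda>\<omega>. \<forall>j<length Bs. Y (Suc n + j) \<omega> \<in> Bs ! j"
    have mH: "{\<omega> \<in> space M. ?H \<omega>} \<in> sets M" by measurable
    have mQ: "{\<omega> \<in> space M. ?Q \<omega>} \<in> sets M"
    proof -
      have "{\<omega> \<in> space M. Y (Suc n + j) \<omega> \<in> Bs ! j} \<in> sets M" if "j < length Bs" for j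
        using Cons.prems that by simp
      then have "{\<omega> \<in> space M. \<forall>j\<in>{..<length Bs}. Y (Suc n + j) \<omega> \<in> Bs ! j} \<in> sets M"
        by (intro sets.sets_Collect_finite_All) auto
      then show ?thesis by (simp only: Ball_def lessThan_iff)
    qed
    have hist: "?H \<omega> \<and> Y (Suc n) \<omega> = t \<longleftrightarrow> (\<forall>i\<le>Suc n. Y i \<omega> = (y(Suc n := t)) i)" for \<omega> t
      by (auto simp: le_Suc_eq)
    have "\<P>(\<omega> in M. ?H \<omega> \<and> (\<forall>j<length (B # Bs). Y (n + j) \<omega> \<in> (B # Bs) ! j)) =
        \<P>(\<omega> in M. ?H \<omega> \<and> ?Q \<omega>)"
      unfolding split using True by (intro arg_cong[where f = prob]) auto
    also have "\<dots> = (\<Sum>t\<in>N (y n). \<P>(\<omega> in M. ?H \<omega> \<and> Y (Suc n) \<omega> = t \<and> ?Q \<omega>))"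
      \<comment> \<open>By \<open>step\<close> the successors of \<open>y n\<close> receive equal
        shares that add up to the mass of the history, as \<open>total\<close> requires.\<close>
      by (rule prob_split[OF mH mQ]) (simp_all add: step)
    also have "\<dots> = (\<Sum>t\<in>N (y n). \<P>(\<omega> in M. ?H \<omega>) / card (N (y n)) * path_prob N Bs t)"
    proof (rule sum.cong)
      fix t assume t: "t \<in> N (y n)"
      have "\<P>(\<omega> in M. ?H \<omega> \<and> Y (Suc n) \<omega> = t \<and> ?Q \<omega>) =
          \<P>(\<omega> in M. (\<forall>i\<le>Suc n. Y i \<omega> = (y(Suc n := t)) i) \<and> ?Q \<omega>)"
        unfolding hist[symmetric] by (simp only: conj_assoc)
      also have "\<dots> = \<P>(\<omega> in M. \<forall>i\<le>Suc n. Y i \<omega> = (y(Suc n := t)) i) * path_prob N Bs t"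
        using Cons.IH[of "Suc n" "y(Suc n := t)"] Cons.prems by simp
      also have "\<P>(\<omega> in M. \<forall>i\<le>Suc n. Y i \<omega> = (y(Suc n := t)) i) = \<P>(\<omega> in M. ?H \<omega>) / card (N (y n))"
        unfolding hist[symmetric] using step[of t y n] t by blast
      finally show "\<P>(\<omega> in M. ?H \<omega> \<and> Y (Suc n) \<omega> = t \<and> ?Q \<omega>) =
          \<P>(\<omega> in M. ?H \<omega>) / card (N (y n)) * path_prob N Bs t" .
    qed simp
    also have "\<dots> = \<P>(\<omega> in M. ?H \<omega>) * path_prob N (B # Bs) (y n)"
      using True by (simp add: avg_def sum_distrib_left sum_divide_distrib)
    finally show ?thesis .
  qed
qed

lemma prob_path:
  assumes "\<And>B n. B \<in> set Bs \<Longrightarrow> {\<omega> \<in> space M. Y n \<omega> \<in> B} \<in> sets M"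
  shows "\<P>(\<omega> in M. \<forall>j<length Bs. Y j \<omega> \<in> Bs ! j) = (\<Sum>s\<in>I. path_prob N Bs s) / card I"
proof -
  have mQ: "{\<omega> \<in> space M. \<forall>j<length Bs. Y j \<omega> \<in> Bs ! j} \<in> sets M"
  proof -
    have "{\<omega> \<in> space M. \<forall>j\<in>{..<length Bs}. Y j \<omega> \<in> Bs ! j} \<in> sets M"
      using assms by (intro sets.sets_Collect_finite_All) auto
    then show ?thesis by (simp only: Ball_def lessThan_iff)
  qed
  have "\<P>(\<omega> in M. True \<and> (\<forall>j<length Bs. Y j \<omega> \<in> Bs ! j)) =
      (\<Sum>s\<in>I. \<P>(\<omega> in M. True \<and> Y 0 \<omega> = s \<and> (\<forall>j<length Bs. Y j \<omega> \<in> Bs ! j)))"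
    by (rule prob_split[OF _ mQ]) (simp_all add: init prob_space)
  also have "\<dots> = (\<Sum>s\<in>I. path_prob N Bs s / card I)"
  proof (rule sum.cong)
    fix s assume "s \<in> I"
    then show "\<P>(\<omega> in M. True \<and> Y 0 \<omega> = s \<and> (\<forall>j<length Bs. Y j \<omega> \<in> Bs ! j)) =
        path_prob N Bs s / card I"
      using prob_history_path[OF assms, of Bs 0 "\<lambda>_. s"] init by simp
  qed simp
  finally show ?thesis by (simp add: sum_divide_distrib)
qed

section \<open>Almost sure visits to a measurable set\<close>

context
  fixes S :: "'s set"
  assumes meas_S [measurable]: "\<And>n. {\<omega> \<in> space M. Y n \<omega> \<in> S} \<in> sets M"
begin

lemma prob_visit: "\<P>(\<omega> in M. Y n \<omega> \<in> S) = (\<Sum>s\<in>I. visit N S n s) / card I"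
proof -
  let ?Bs = "replicate n UNIV @ [S]"
  have "(\<forall>j<length ?Bs. Y j \<omega> \<in> ?Bs ! j) \<longleftrightarrow> Y n \<omega> \<in> S" for \<omega>
    by (auto simp: nth_append less_Suc_eq)
  moreover have "\<P>(\<omega> in M. \<forall>j<length ?Bs. Y j \<omega> \<in> ?Bs ! j) = (\<Sum>s\<in>I. path_prob N ?Bs s) / card I"
    by (rule prob_path) (auto simp: meas_S)
  ultimately show ?thesis by (simp only: path_prob_UNIV_append)
qed

lemma AE_finite_visits:
  assumes "\<And>s. s \<in> I \<Longrightarrow> summable (\<lambda>n. visit N S n s)"
  shows "AE \<omega> in M. finite {n. Y n \<omega> \<in> S}"
proof -
  have "AE \<omega> in M. \<forall>\<^sub>F n in sequentially. \<omega> \<in> space M - {\<omega> \<in> space M. Y n \<omega> \<in> S}"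
  proof (rule borel_cantelli_AE1)
    show "summable (\<lambda>n. prob {\<omega> \<in> space M. Y n \<omega> \<in> S})"
      unfolding prob_visit using assms by (intro summable_divide summable_sum) auto
  qed (simp_all add: meas_S less_top[symmetric])
  then show ?thesis
  proof eventually_elim
    case (elim \<omega>)
    then have "\<forall>\<^sub>F n in sequentially. Y n \<omega> \<notin> S" by eventually_elim auto
    then show ?case by (simp add: eventually_cofinite flip: cofinite_eq_sequentially)
  qed
qed

text \<open>The event that time \<open>n\<close> is the last visit is contained, for every
  \<open>k\<close>, in that of a visit followed by \<open>k\<close> steps outside \<open>S\<close>,
  so its probability is 0. A nonempty finite set of visit times would have a maximum.\<close>

lemma AE_infinite_visits:
  assumes I: "I \<subseteq> S" and lim: "\<And>s. s \<in> S \<Longrightarrow> (\<lambda>n. avoid N S n s) \<longlonglongrightarrow> 0"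
  shows "AE \<omega> in M. infinite {n. Y n \<omega> \<in> S}"
proof -
  have last: "AE \<omega> in M. \<not> (Y n \<omega> \<in> S \<and> (\<forall>j>n. Y j \<omega> \<notin> S))" for n
  proof -
    let ?E = "{\<omega> \<in> space M. Y n \<omega> \<in> S \<and> (\<forall>j>n. Y j \<omega> \<notin> S)}"
    have m: "?E \<in> sets M" by measurable
    have "prob ?E \<le> (\<Sum>s\<in>I. (avg N ^^ n) (\<lambda>s. indicat_real S s * avoid N S k s) s) / card I" for k
    proof -
      let ?Bs = "replicate n UNIV @ S # replicate k (- S)"
      have "prob ?E \<le> \<P>(\<omega> in M. \<forall>j<length ?Bs. Y j \<omega> \<in> ?Bs ! j)"
      proof (rule finite_measure_mono)
        show "?E \<subseteq> {\<omega> \<in> space M. \<forall>j<length ?Bs. Y j \<omega> \<in> ?Bs ! j}"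
        proof safe
          fix \<omega> j assume *: "Y n \<omega> \<in> S" "\<forall>j>n. Y j \<omega> \<notin> S" "j < length ?Bs"
          consider "j < n" | "j = n" | "j > n" by linarith
          then show "Y j \<omega> \<in> ?Bs ! j"
            using * by cases (auto simp: nth_append nth_Cons')
        qed
        have "{\<omega> \<in> space M. Y j \<omega> \<in> ?Bs ! j} \<in> sets M" if "j < length ?Bs" for j
        proof -
          have "?Bs ! j \<in> set ?Bs" using that by (rule nth_mem)
          then consider "?Bs ! j = UNIV" | "?Bs ! j = S" | "?Bs ! j = - S" by fastforce
          then show ?thesis by cases (simp_all only:, simp_all, measurable)
        qed
        then have "{\<omega> \<in> space M. \<forall>j\<in>{..<length ?Bs}. Y j \<omega> \<in> ?Bs ! j} \<in> sets M"
          by (intro sets.sets_Collect_finite_All) (auto simp del: length_append)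
        then show "{\<omega> \<in> space M. \<forall>j<length ?Bs. Y j \<omega> \<in> ?Bs ! j} \<in> sets M"
          by (simp only: Ball_def lessThan_iff)
      qed
      also have "\<dots> = (\<Sum>s\<in>I. path_prob N ?Bs s) / card I"
      proof (rule prob_path)
        fix B m assume "B \<in> set ?Bs"
        then consider "B = UNIV" | "B = S" | "B = - S" by fastforce
        then show "{\<omega> \<in> space M. Y m \<omega> \<in> B} \<in> sets M"
          by cases (simp_all only:, simp_all, measurable)
      qed
      finally show ?thesis unfolding path_prob_last_visit .
    qed
    moreover have "(\<lambda>k. (\<Sum>s\<in>I. (avg N ^^ n) (\<lambda>s. indicat_real S s * avoid N S k s) s) / card I)
        \<longlonglongrightarrow> (\<Sum>s\<in>I. 0) / card I"
    proof (intro tendsto_intros avgpow_tendsto_0)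
      show "(\<lambda>k. indicat_real S s * avoid N S k s) \<longlonglongrightarrow> 0" for s
        using lim[of s] by (cases "s \<in> S") (auto simp: indicator_def)
    qed simp
    ultimately have "prob ?E \<le> (\<Sum>s\<in>I. 0) / card I"
      by (intro LIMSEQ_le_const) blast+
    then have "prob ?E = 0" by (simp add: measure_le_0_iff)
    then show ?thesis using m by (subst (asm) prob_eq_0) auto
  qed
  have start: "AE \<omega> in M. Y 0 \<omega> \<in> S"
  proof -
    have "visit N S 0 s = 1" if "s \<in> I" for s using that I by auto
    then have "\<P>(\<omega> in M. Y 0 \<omega> \<in> S) = 1" unfolding prob_visit by simp
    then show ?thesis by (subst (asm) prob_Collect_eq_1) auto
  qed
  have "AE \<omega> in M. \<forall>n. \<not> (Y n \<omega> \<in> S \<and> (\<forall>j>n. Y j \<omega> \<notin> S))"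
    using last by (simp add: AE_all_countable)
  with start show ?thesis
  proof eventually_elim
    case (elim \<omega>)
    show ?case
    proof
      assume fin: "finite {n. Y n \<omega> \<in> S}"
      then have "Max {n. Y n \<omega> \<in> S} \<in> {n. Y n \<omega> \<in> S}" using elim by (intro Max_in) auto
      moreover have "Y j \<omega> \<notin> S" if "j > Max {n. Y n \<omega> \<in> S}" for j
        using Max_ge[OF fin, of j] that by auto
      ultimately show False using elim by blast
    qed
  qed
qed

end

end

subsection \<open>Biregular graphs\<close>

text \<open>Stated symmetrically in \<open>k1\<close> and \<open>k2\<close>, so that one argument
  covers a vertex \<open>v\<close> of either class.\<close>

locale biregular_graph =
  fixes V :: "'a set" and adj :: "'a \<Rightarrow> 'a \<Rightarrow> bool" and k1 k2 :: nat
  assumes k1: "2 \<le> k1" and k2: "2 \<le> k2" and k1_neq_k2: "k1 \<noteq> k2"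
    and graph: "simple_graph V adj"
    and deg_cases: "x \<in> V \<Longrightarrow> deg adj x = k1 \<or> deg adj x = k2"
    and deg_k1: "adj x y \<Longrightarrow> deg adj x = k1 \<Longrightarrow> deg adj y = k2"
    and deg_k2: "adj x y \<Longrightarrow> deg adj x = k2 \<Longrightarrow> deg adj y = k1"
begin

abbreviation nb :: "'a \<Rightarrow> 'a set" where "nb x \<equiv> {y. adj x y}"

text \<open>For \<open>x\<close> in \<open>V\<close> this is the common degree of its neighbours,
  the other one of \<open>k1\<close> and \<open>k2\<close>.\<close>

definition codeg :: "'a \<Rightarrow> nat" where "codeg x = k1 + k2 - deg adj x"

lemma adj_V: "adj x y \<Longrightarrow> x \<in> V" "adj x y \<Longrightarrow> y \<in> V"
  and adj_sym: "adj x y \<Longrightarrow> adj y x"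
  and adj_irrefl: "\<not> adj x x"
  using graph by (auto simp: simple_graph_def)

lemma deg_ge_2: "x \<in> V \<Longrightarrow> 2 \<le> deg adj x"
  using deg_cases[of x] k1 k2 by auto

lemma codeg_ge_2: "x \<in> V \<Longrightarrow> 2 \<le> codeg x"
  using deg_cases[of x] k1 k2 by (auto simp: codeg_def)

lemma deg_neighbour: "adj x y \<Longrightarrow> deg adj y = codeg x"
  using deg_cases[of x] deg_k1[of x y] deg_k2[of x y] adj_V[of x y] by (auto simp: codeg_def)

lemma codeg_neighbour: "adj x y \<Longrightarrow> codeg y = deg adj x"
  using deg_neighbour[of y x] adj_sym by simp

lemma deg_neighbour_neq: "adj x y \<Longrightarrow> deg adj y \<noteq> deg adj x"
  using deg_cases[of x] deg_k1[of x y] deg_k2[of x y] adj_V[of x y] k1_neq_k2 by auto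

lemma finite_nb: "x \<in> V \<Longrightarrow> finite (nb x)"
  using deg_ge_2[of x] by (auto simp: deg_def intro: card_ge_0_finite)

lemma card_nb: "card (nb x) = deg adj x"
  by (simp add: deg_def)

lemma nb_nonempty: "x \<in> V \<Longrightarrow> nb x \<noteq> {}"
  using deg_ge_2[of x] card_nb[of x] by (metis card.empty not_numeral_le_zero)

lemma card_nb_diff: "adj x y \<Longrightarrow> card (nb y - {x}) = deg adj y - 1"
  using adj_sym card_nb by (simp add: card_Diff_singleton)

section \<open>The two walks as uniform kernels\<close>

text \<open>Both kernels are made total by letting states outside the graph stay put.\<close>

definition srw_nb :: "'a \<Rightarrow> 'a set" where
  "srw_nb x = (if x \<in> V then nb x else {x})"

definition nbrw_nb :: "'a \<times> 'a \<Rightarrow> ('a \<times> 'a) set" where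
  "nbrw_nb e = (if adj (fst e) (snd e) then Pair (snd e) ` (nb (snd e) - {fst e}) else {e})"

lemma nbrw_nb_edge: "adj x y \<Longrightarrow> nbrw_nb (x, y) = Pair y ` (nb y - {x})"
  by (simp add: nbrw_nb_def)

lemma card_nbrw_nb: "adj x y \<Longrightarrow> card (nbrw_nb (x, y)) = deg adj y - 1"
  by (simp add: nbrw_nb_edge card_image inj_on_def card_nb_diff)

sublocale srw: uniform_kernel srw_nb
  by unfold_locales (use finite_nb nb_nonempty in \<open>auto simp: srw_nb_def\<close>)

sublocale nbrw: uniform_kernel nbrw_nb
proof
  fix e
  show "finite (nbrw_nb e)" using finite_nb adj_V by (auto simp: nbrw_nb_def)
  show "nbrw_nb e \<noteq> {}"
  proof (cases "adj (fst e) (snd e)")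
    case True
    then have "card (nbrw_nb e) \<noteq> 0"
      using card_nbrw_nb[of "fst e" "snd e"] deg_ge_2[of "snd e"] adj_V by simp
    then show ?thesis by auto
  qed (simp add: nbrw_nb_def)
qed

text \<open>All pairs with first entry \<open>v\<close> belong to it, edges or not, so that
  \<open>(X n, X (Suc n))\<close> lies in it exactly when \<open>X n = v\<close>.\<close>

definition out_edges :: "'a \<Rightarrow> ('a \<times> 'a) set" where
  "out_edges v = {e. fst e = v}"

section \<open>A recursion for non-backtracking visits\<close>

text \<open>\<open>deg x\<close> times the probability that the non-backtracking walk from \<open>x\<close> is at \<open>v\<close> at time \<open>n\<close>.\<close>

definition nb_visit :: "'a \<Rightarrow> nat \<Rightarrow> 'a \<Rightarrow> real" where
  "nb_visit v n x = (\<Sum>y\<in>nb x. visit nbrw_nb (out_edges v) n (x, y))"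

lemma nb_visit_nonneg: "0 \<le> nb_visit v n x"
  by (simp add: nb_visit_def sum_nonneg visit_nonneg)

lemma nb_visit_le: assumes "x \<in> V" shows "nb_visit v n x \<le> k1 + k2"
proof -
  have "nb_visit v n x \<le> (\<Sum>y\<in>nb x. 1)"
    unfolding nb_visit_def by (intro sum_mono nbrw.visit_le_1)
  also have "\<dots> \<le> k1 + k2" using deg_cases[OF assms] by (auto simp: card_nb)
  finally show ?thesis .
qed

text \<open>The steps from \<open>(x, y)\<close> lead to all edges out of \<open>y\<close> but the
  reversed one \<open>(y, x)\<close>, whose contribution is subtracted.\<close>

lemma visit_edge_Suc:
  assumes "adj x y"
  shows "(real (deg adj y) - 1) * visit nbrw_nb (out_edges v) (Suc n) (x, y) =
    nb_visit v n y - visit nbrw_nb (out_edges v) n (y, x)"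
proof -
  let ?u = "visit nbrw_nb (out_edges v) n"
  have y: "y \<in> V" "adj y x" using assms adj_V adj_sym by auto
  have "visit nbrw_nb (out_edges v) (Suc n) (x, y) =
      (\<Sum>z\<in>nb y - {x}. ?u (y, z)) / (real (deg adj y) - 1)"
    using deg_ge_2[OF y(1)]
    unfolding avg_def funpow.simps comp_def card_nbrw_nb[OF assms]
    by (simp add: nbrw_nb_edge[OF assms] sum.reindex inj_on_def)
  then show ?thesis
    using deg_ge_2[OF y(1)] finite_nb[OF y(1)] y(2) by (simp add: nb_visit_def sum_diff1)
qed

lemma nb_visit_0: "nb_visit v 0 x = (if x = v then deg adj x else 0)"
  by (simp add: nb_visit_def out_edges_def indicator_def card_nb)

lemma nb_visit_1:
  assumes "x \<in> V"
  shows "nb_visit v 1 x = (if adj x v then 1 else 0)"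
proof -
  have "visit nbrw_nb (out_edges v) 1 (x, y) = (if y = v then 1 else 0)" if "adj x y" for y
  proof -
    have "(real (deg adj y) - 1) * visit nbrw_nb (out_edges v) 1 (x, y) =
        (real (deg adj y) - 1) * (if y = v then 1 else 0)"
      using visit_edge_Suc[OF that, where v = v and n = 0]
      by (auto simp: nb_visit_0 out_edges_def indicator_def)
    moreover have "real (deg adj y) - 1 \<noteq> 0" using deg_ge_2[of y] adj_V that by auto
    ultimately show ?thesis by (simp only: mult_cancel_left) blast
  qed
  then have "nb_visit v 1 x = (\<Sum>y\<in>nb x. if y = v then 1 else 0)"
    unfolding nb_visit_def by (intro sum.cong) auto
  then show ?thesis using finite_nb[OF assms] by simp
qed

text \<open>Summing \<open>visit_edge_Suc\<close> over the edges out of \<open>x\<close> leaves a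
  sum over the reversed edges \<open>(y, x)\<close>. A second use of \<open>visit_edge_Suc\<close>
  evaluates that sum.\<close>

lemma nb_visit_Suc_Suc:
  assumes "x \<in> V"
  shows "(real (codeg x) - 1) * nb_visit v (Suc (Suc n)) x =
    (\<Sum>y\<in>nb x. nb_visit v (Suc n) y) - nb_visit v n x"
proof -
  let ?u = "visit nbrw_nb (out_edges v)"
  \<comment> \<open>Each edge out of \<open>x\<close> follows all but one of the edges into
    \<open>x\<close>, so the factor \<open>deg adj x - 1\<close> appears on both sides and
    cancels.\<close>
  have "(real (deg adj x) - 1) * (\<Sum>y\<in>nb x. ?u (Suc n) (y, x)) =
      (\<Sum>y\<in>nb x. nb_visit v n x - ?u n (x, y))"
    unfolding sum_distrib_left by (intro sum.cong visit_edge_Suc) (auto intro: adj_sym)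
  also have "\<dots> = (real (deg adj x) - 1) * nb_visit v n x"
    unfolding sum_subtractf nb_visit_def[symmetric] by (simp add: card_nb algebra_simps)
  finally have "(\<Sum>y\<in>nb x. ?u (Suc n) (y, x)) = nb_visit v n x"
    using deg_ge_2[OF assms] by auto
  moreover have "(real (codeg x) - 1) * nb_visit v (Suc (Suc n)) x =
      (\<Sum>y\<in>nb x. nb_visit v (Suc n) y - ?u (Suc n) (y, x))"
    unfolding nb_visit_def[of v "Suc (Suc n)"] sum_distrib_left
  proof (rule sum.cong)
    fix y assume "y \<in> nb x"
    then show "(real (codeg x) - 1) * ?u (Suc (Suc n)) (x, y) =
        nb_visit v (Suc n) y - ?u (Suc n) (y, x)"
      using visit_edge_Suc[of x y, where v = v and n = "Suc n"] deg_neighbour[of x y] by simp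
  qed simp
  ultimately show ?thesis by (simp add: sum_subtractf)
qed

text \<open>Each step changes the degree class, so the walk can be in the class of \<open>v\<close>
  only at times of one parity; the equivalence in the premise says that \<open>n\<close> has the
  wrong parity.\<close>

lemma srw_visit_odd:
  assumes "v \<in> V"
  shows "x \<in> V \<Longrightarrow> even n \<longleftrightarrow> deg adj x \<noteq> deg adj v \<Longrightarrow> visit srw_nb {v} n x = 0"
proof (induction n arbitrary: x)
  case 0
  then show ?case by (auto simp: indicator_def)
next
  case (Suc n)
  have "visit srw_nb {v} n y = 0" if "adj x y" for y
  proof (rule Suc.IH)
    show "y \<in> V" using that adj_V by auto
    have "deg adj y \<noteq> deg adj x" using deg_neighbour_neq[OF that] .
    then show "even n \<longleftrightarrow> deg adj y \<noteq> deg adj v"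
      using Suc.prems deg_cases[OF \<open>y \<in> V\<close>] deg_cases[OF \<open>x \<in> V\<close>] deg_cases[OF assms]
      by (metis even_Suc)
  qed
  then show ?case using Suc.prems(1) by (simp add: avg_def[of _ _ x] srw_nb_def[of x])
qed

section \<open>Generating functions as Green functions of the simple walk\<close>

definition green :: "'a \<Rightarrow> real \<Rightarrow> 'a \<Rightarrow> real" where
  "green v r x = (\<Sum>n. r ^ n * nb_visit v n x) - (if x = v then 1 else 0)"

text \<open>The weight that two steps of the simple walk pick up; it is 1 at
  \<open>r = 1\<close>.\<close>

definition ratio :: "real \<Rightarrow> real" where
  "ratio r = r\<^sup>2 * (k1 * k2) / ((real k1 - 1 + r\<^sup>2) * (real k2 - 1 + r\<^sup>2))"

definition source :: "'a \<Rightarrow> real \<Rightarrow> real" where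
  "source v r = ((real k1 - 1) * (real k2 - 1) - r\<^sup>2) / (real (codeg v) - 1 + r\<^sup>2)"

text \<open>The last bound is strict because \<open>k1 \<noteq> k2\<close> excludes two degrees
  equal to 2; this keeps \<open>source v r\<close> away from 0 as \<open>r\<close> tends to
  1.\<close>

lemma k_bounds: "1 \<le> real k1 - 1" "1 \<le> real k2 - 1" "1 < (real k1 - 1) * (real k2 - 1)"
proof -
  show *: "1 \<le> real k1 - 1" "1 \<le> real k2 - 1" using k1 k2 by auto
  have "2 \<le> real k1 - 1 \<or> 2 \<le> real k2 - 1" using k1 k2 k1_neq_k2 by auto
  then show "1 < (real k1 - 1) * (real k2 - 1)"
    using * mult_mono[of 2 "real k1 - 1" 1 "real k2 - 1"] mult_mono[of 1 "real k1 - 1" 2 "real k2 - 1"]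
    by auto
qed

context
  fixes v :: 'a and r :: real
  assumes v: "v \<in> V" and r: "0 < r" "r < 1"
begin

lemma nb_visit_sums:
  assumes "x \<in> V"
  shows "(\<lambda>n. r ^ n * nb_visit v n x) sums (green v r x + (if x = v then 1 else 0))"
proof -
  have "summable (\<lambda>n. r ^ n * nb_visit v n x)"
  proof (rule summable_comparison_test')
    show "summable (\<lambda>n. r ^ n * (k1 + k2))"
      using r by (intro summable_mult2 summable_geometric) auto
    show "norm (r ^ n * nb_visit v n x) \<le> r ^ n * (k1 + k2)" for n
      using r nb_visit_le[OF assms, of v n] nb_visit_nonneg[of v n x] by (simp add: abs_mult)
  qed
  then show ?thesis by (simp add: green_def summable_sums)
qed

text \<open>Crude and not uniform in \<open>r\<close>; it serves to discard the remainder when the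
  equation for \<open>green\<close> is iterated.\<close>

lemma green_bounds:
  assumes "x \<in> V"
  shows "\<bar>green v r x\<bar> \<le> (k1 + k2) / (1 - r) + 1"
proof -
  let ?g = "green v r x + (if x = v then 1 else 0)"
  have g: "(\<lambda>n. r ^ n * nb_visit v n x) sums ?g" using assms by (rule nb_visit_sums)
  have "(\<lambda>n. r ^ n * (k1 + k2)) sums (1 / (1 - r) * (k1 + k2))"
    using r by (intro sums_mult2 geometric_sums) auto
  then have "?g \<le> 1 / (1 - r) * (k1 + k2)"
    using r nb_visit_le[OF assms, of v] by (intro sums_le[OF _ g]) auto
  moreover have "0 \<le> ?g"
    using r nb_visit_nonneg by (intro sums_le[OF _ sums_zero g]) auto
  ultimately show ?thesis by (auto split: if_splits)
qed

text \<open>Multiply the recursion by \<open>r ^ (n + 2)\<close> and sum over \<open>n\<close>. The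
  values at times 0 and 1 give boundary terms at \<open>v\<close> and its neighbours; the correction
  at \<open>v\<close> in \<open>green\<close> cancels those at the neighbours.\<close>

lemma green_equation:
  assumes x: "x \<in> V"
  shows "(real (codeg x) - 1 + r\<^sup>2) * green v r x = r * (\<Sum>y\<in>nb x. green v r y) +
    (if x = v then (real k1 - 1) * (real k2 - 1) - r\<^sup>2 else 0)"
proof -
  define g where "g y = green v r y + (if y = v then 1 else 0)" for y
  define d where "d = real (codeg x) - 1"
  have g: "(\<lambda>n. r ^ n * nb_visit v n y) sums g y" if "y \<in> V" for y
    unfolding g_def using that by (rule nb_visit_sums)
  have tail: "(\<lambda>n. r ^ Suc n * nb_visit v (Suc n) y) sums (g y - nb_visit v 0 y)" if "y \<in> V" for y
    using g[OF that] by (subst sums_Suc_iff) simp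
  have "(\<lambda>n. d * (r ^ Suc (Suc n) * nb_visit v (Suc (Suc n)) x)) sums
      (d * (g x - nb_visit v 0 x - r * nb_visit v 1 x))"
    by (intro sums_mult, subst sums_Suc_iff) (use tail[OF x] in simp)
  moreover have "d * (r ^ Suc (Suc n) * nb_visit v (Suc (Suc n)) x) =
      r * (\<Sum>y\<in>nb x. r ^ Suc n * nb_visit v (Suc n) y) - r\<^sup>2 * (r ^ n * nb_visit v n x)" for n
  proof -
    have "d * (r ^ Suc (Suc n) * nb_visit v (Suc (Suc n)) x) =
       r ^ Suc (Suc n) * (d * nb_visit v (Suc (Suc n)) x)" by (simp only: mult_ac)
    also have "\<dots> = r ^ Suc (Suc n) * ((\<Sum>y\<in>nb x. nb_visit v (Suc n) y) - nb_visit v n x)"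
      unfolding d_def nb_visit_Suc_Suc[OF x] ..
    finally show ?thesis
      by (simp add: right_diff_distrib sum_distrib_left[symmetric] power2_eq_square mult_ac)
  qed
  moreover have "(\<lambda>n. r * (\<Sum>y\<in>nb x. r ^ Suc n * nb_visit v (Suc n) y) - r\<^sup>2 * (r ^ n * nb_visit v n x))
      sums (r * (\<Sum>y\<in>nb x. g y - nb_visit v 0 y) - r\<^sup>2 * g x)"
    by (intro sums_diff sums_mult sums_sum tail g x) (auto intro: adj_V)
  ultimately have "d * (g x - nb_visit v 0 x - r * nb_visit v 1 x) =
      r * (\<Sum>y\<in>nb x. g y - nb_visit v 0 y) - r\<^sup>2 * g x"
    by (simp add: sums_unique2)
  \<comment> \<open>If \<open>v\<close> is a neighbour of \<open>x\<close>, its term is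
    \<open>green v r v + 1 - deg adj v\<close>.\<close>
  moreover have "(\<Sum>y\<in>nb x. g y - nb_visit v 0 y) =
      (\<Sum>y\<in>nb x. green v r y) - (if adj x v then real (deg adj v) - 1 else 0)"
  proof -
    have "(\<Sum>y\<in>nb x. g y - nb_visit v 0 y) =
        (\<Sum>y\<in>nb x. green v r y - (if y = v then real (deg adj v) - 1 else 0))"
      by (intro sum.cong) (auto simp: g_def nb_visit_0)
    then show ?thesis using finite_nb[OF x] by (simp add: sum_subtractf)
  qed
  ultimately have eq: "d * (g x - nb_visit v 0 x - r * nb_visit v 1 x) =
      r * ((\<Sum>y\<in>nb x. green v r y) - (if adj x v then real (deg adj v) - 1 else 0)) - r\<^sup>2 * g x"
    by simp
  show ?thesis
  proof (cases "x = v")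
    case True
    then have "(real k1 - 1) * (real k2 - 1) = d * (real (deg adj v) - 1)"
      using deg_cases[OF v] by (auto simp: d_def codeg_def)
    moreover have "nb_visit v 0 x = deg adj v" "nb_visit v 1 x = 0" "g x = green v r x + 1"
      using True adj_irrefl[of v] nb_visit_1[OF x] by (simp_all add: nb_visit_0 g_def)
    ultimately show ?thesis unfolding d_def[symmetric]
      using True eq adj_irrefl[of v] by (simp add: algebra_simps)
  next
    case False
    \<comment> \<open>If \<open>x\<close> is adjacent to \<open>v\<close>, this makes both sides
      carry the boundary term \<open>- r * d\<close>.\<close>
    have "adj x v \<Longrightarrow> real (deg adj v) = d + 1" by (simp add: d_def deg_neighbour)
    moreover have "nb_visit v 0 x = 0" "nb_visit v 1 x = (if adj x v then 1 else 0)" "g x = green v r x"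
      using False nb_visit_1[OF x] by (simp_all add: nb_visit_0 g_def)
    ultimately show ?thesis unfolding d_def[symmetric]
      using False eq by (cases "adj x v") (simp_all add: algebra_simps)
  qed
qed

lemma green_avg:
  assumes "x \<in> V"
  shows "green v r x = r * deg adj x / (real (codeg x) - 1 + r\<^sup>2) * avg srw_nb (green v r) x +
    (if x = v then source v r else 0)"
proof -
  define D where "D = real (codeg x) - 1 + r\<^sup>2"
  have D: "D > 0" using codeg_ge_2[OF assms] by (simp add: D_def add_pos_nonneg)
  have sum: "(\<Sum>y\<in>nb x. green v r y) = deg adj x * avg srw_nb (green v r) x"
    using assms deg_ge_2[OF assms] by (simp add: avg_def srw_nb_def card_nb)
  have "D * green v r x = r * (deg adj x * avg srw_nb (green v r) x) +
      (if x = v then (real k1 - 1) * (real k2 - 1) - r\<^sup>2 else 0)"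
    using green_equation[OF assms] unfolding sum D_def .
  also have "\<dots> = D * (r * deg adj x / D * avg srw_nb (green v r) x + (if x = v then source v r else 0))"
    using D by (auto simp: source_def distrib_left D_def)
  finally show ?thesis using D by (simp flip: D_def)
qed

text \<open>A neighbour of \<open>x\<close> lies in the other class, so it is not \<open>v\<close>
  and has no source term; substituting \<open>green_avg\<close> there eliminates that class, and the
  two factors multiply to \<open>ratio r\<close>.\<close>

lemma green_two_steps:
  assumes x: "x \<in> V" "deg adj x = deg adj v"
  shows "green v r x = ratio r * avg srw_nb (avg srw_nb (green v r)) x + source v r * indicat_real {v} x"
proof -
  have "avg srw_nb (green v r) x =
      avg srw_nb (\<lambda>y. r * codeg x / (real (deg adj x) - 1 + r\<^sup>2) * avg srw_nb (green v r) y) x"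
  proof (rule avg_cong)
    fix y assume "y \<in> srw_nb x"
    then have y: "adj x y" using x by (simp add: srw_nb_def)
    then have "y \<noteq> v" using deg_neighbour_neq x by metis
    then show "green v r y = r * codeg x / (real (deg adj x) - 1 + r\<^sup>2) * avg srw_nb (green v r) y"
      using green_avg[of y] adj_V[OF y] deg_neighbour[OF y] codeg_neighbour[OF y] by simp
  qed
  also have "\<dots> = r * codeg x / (real (deg adj x) - 1 + r\<^sup>2) * avg srw_nb (avg srw_nb (green v r)) x"
    by (rule avg_cmult)
  finally have "green v r x = r * deg adj x / (real (codeg x) - 1 + r\<^sup>2) *
      (r * codeg x / (real (deg adj x) - 1 + r\<^sup>2) * avg srw_nb (avg srw_nb (green v r)) x) +
      (if x = v then source v r else 0)"
    using green_avg[OF x(1)] by simp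
  also have "r * deg adj x / (real (codeg x) - 1 + r\<^sup>2) *
      (r * codeg x / (real (deg adj x) - 1 + r\<^sup>2) * avg srw_nb (avg srw_nb (green v r)) x) =
      ratio r * avg srw_nb (avg srw_nb (green v r)) x"
    using deg_cases[OF x(1)] by (auto simp: ratio_def codeg_def power2_eq_square mult_ac)
  finally show ?thesis by (simp add: indicator_def)
qed

lemma green_iterate:
  assumes "x \<in> V" "deg adj x = deg adj v"
  shows "green v r x = source v r * (\<Sum>j<n. ratio r ^ j * visit srw_nb {v} (2 * j) x) +
    ratio r ^ n * (avg srw_nb ^^ (2 * n)) (green v r) x"
  using assms
proof (induction n arbitrary: x)
  case 0
  show ?case by simp
next
  case (Suc n)
  let ?A = "avg srw_nb"
  have "?A (?A (green v r)) x = ?A (?A (\<lambda>z. source v r * (\<Sum>j<n. ratio r ^ j * visit srw_nb {v} (2 * j) z) +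
      ratio r ^ n * (?A ^^ (2 * n)) (green v r) z)) x"
  proof (intro avg_cong)
    fix y z assume "y \<in> srw_nb x" "z \<in> srw_nb y"
    then have "adj x y" "adj y z" using Suc.prems adj_V by (auto simp: srw_nb_def split: if_splits)
    then have "z \<in> V" "deg adj z = deg adj v"
      using Suc.prems adj_V deg_neighbour codeg_neighbour by metis+
    then show "green v r z = source v r * (\<Sum>j<n. ratio r ^ j * visit srw_nb {v} (2 * j) z) +
        ratio r ^ n * (?A ^^ (2 * n)) (green v r) z" by (rule Suc.IH)
  qed
  also have "\<dots> = source v r * (\<Sum>j<n. ratio r ^ j * visit srw_nb {v} (2 * Suc j) x) +
      ratio r ^ n * (?A ^^ (2 * Suc n)) (green v r) x"
    by (simp add: avg_add[abs_def] avg_cmult[abs_def] avg_sum[abs_def])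
  finally have "green v r x = ratio r * (source v r * (\<Sum>j<n. ratio r ^ j * visit srw_nb {v} (2 * Suc j) x) +
      ratio r ^ n * (?A ^^ (2 * Suc n)) (green v r) x) + source v r * indicat_real {v} x"
    using green_two_steps[OF Suc.prems] by simp
  then show ?case
    by (simp add: sum.lessThan_Suc_shift sum_distrib_left algebra_simps
        del: sum.lessThan_Suc)
qed

lemma ratio_bounds: "0 \<le> ratio r" "ratio r < 1"
proof -
  define s where "s = r\<^sup>2"
  have s: "0 \<le> s" "s < 1" using r by (auto simp: s_def power_less_one_iff)
  have pos: "0 < (real k1 - 1 + s) * (real k2 - 1 + s)"
    using k_bounds s by (intro mult_pos_pos) auto
  then show "0 \<le> ratio r" using s by (simp add: ratio_def flip: s_def)
  \<comment> \<open>The denominator of \<open>ratio r\<close> minus its numerator factors in this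
    way, with \<open>s = r\<^sup>2\<close>.\<close>
  have "0 < (1 - s) * ((real k1 - 1) * (real k2 - 1) - s)"
    using k_bounds s by (intro mult_pos_pos) auto
  also have "\<dots> = (real k1 - 1 + s) * (real k2 - 1 + s) - s * (real k1 * real k2)"
    by (simp add: algebra_simps)
  finally show "ratio r < 1" using pos by (simp add: ratio_def flip: s_def)
qed

lemma source_nonneg: "0 \<le> source v r"
proof -
  have "r\<^sup>2 \<le> 1" using r by (simp add: power_le_one)
  then show ?thesis using k_bounds codeg_ge_2[OF v] by (auto simp: source_def)
qed

text \<open>The remainder of \<open>green_iterate\<close> is a bounded quantity times
  \<open>ratio r ^ n\<close> and vanishes as \<open>n\<close> grows.\<close>

lemma green_sums:
  "(\<lambda>j. source v r * (ratio r ^ j * visit srw_nb {v} (2 * j) v)) sums green v r v"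
proof -
  define B where "B = (k1 + k2) / (1 - r) + 1"
  \<comment> \<open>The bound on \<open>green\<close> holds on \<open>V\<close> only; the walk from
    \<open>v\<close> stays in \<open>V\<close>, so a cut-off outside \<open>V\<close> does not
    change the values at \<open>v\<close>.\<close>
  define f where "f x = (if x \<in> V then green v r x else 0)" for x
  have "(avg srw_nb ^^ n) (green v r) x = (avg srw_nb ^^ n) f x" if "x \<in> V" for x n
    using that
  proof (induction n arbitrary: x)
    case (Suc n)
    have "y \<in> V" if "y \<in> srw_nb x" for y
      using that Suc.prems adj_V(2) by (auto simp: srw_nb_def)
    then have "avg srw_nb ((avg srw_nb ^^ n) (green v r)) x = avg srw_nb ((avg srw_nb ^^ n) f) x"
      by (intro avg_cong Suc.IH)
    then show ?case by simp
  qed (simp add: f_def)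
  moreover have "\<bar>(avg srw_nb ^^ n) f x\<bar> \<le> B" for n x
    by (rule srw.avgpow_abs_le) (use green_bounds r in \<open>auto simp: f_def B_def\<close>)
  ultimately have B: "\<bar>(avg srw_nb ^^ n) (green v r) v\<bar> \<le> B" for n using v by simp
  have "(\<lambda>n. ratio r ^ n * (avg srw_nb ^^ (2 * n)) (green v r) v) \<longlonglongrightarrow> 0"
  proof (rule tendsto_0_le[where K = B])
    show "(\<lambda>n. ratio r ^ n) \<longlonglongrightarrow> 0" using ratio_bounds by (intro LIMSEQ_power_zero) auto
    show "\<forall>\<^sub>F n in sequentially.
        norm (ratio r ^ n * (avg srw_nb ^^ (2 * n)) (green v r) v) \<le> norm (ratio r ^ n) * B"
      using B by (intro always_eventually allI) (auto simp: abs_mult intro!: mult_left_mono)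
  qed
  then have "(\<lambda>n. green v r v - ratio r ^ n * (avg srw_nb ^^ (2 * n)) (green v r) v) \<longlonglongrightarrow> green v r v - 0"
    by (intro tendsto_intros)
  moreover have "green v r v - ratio r ^ n * (avg srw_nb ^^ (2 * n)) (green v r) v =
      (\<Sum>j<n. source v r * (ratio r ^ j * visit srw_nb {v} (2 * j) v))" for n
    using green_iterate[OF v refl, of n] by (simp add: sum_distrib_left)
  ultimately show ?thesis by (simp add: sums_def)
qed

end

text \<open>The terms are nonnegative, so it suffices to bound partial sums. Each is the limit of
  its discounted version as \<open>r\<close> tends to 1 from below, and for \<open>r < 1\<close> the
  two series are linked through \<open>green v r v\<close>.\<close>

lemma summable_nb_visit_iff:
  assumes v: "v \<in> V"
  shows "summable (\<lambda>n. nb_visit v n v) \<longleftrightarrow> summable (\<lambda>n. visit srw_nb {v} n v)"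
proof -
  let ?p = "\<lambda>j. visit srw_nb {v} (2 * j) v"
  have "summable (\<lambda>n. visit srw_nb {v} n v) \<longleftrightarrow> summable ?p"
  proof (rule summable_mono_reindex[symmetric])
    show "strict_mono (\<lambda>j. 2 * j :: nat)" by (simp add: strict_mono_def)
    fix n assume "n \<notin> range (\<lambda>j. 2 * j :: nat)"
    then have "odd n" by (auto elim!: evenE)
    then show "visit srw_nb {v} n v = 0" by (intro srw_visit_odd[OF v v]) simp
  qed
  moreover have "summable (\<lambda>n. nb_visit v n v)" if p: "summable ?p"
  proof -
    \<comment> \<open>The product of the degrees minus 1 bounds \<open>source v r\<close>, whose
      denominator is at least 1; the final 1 is the correction at \<open>v\<close> in
      \<open>green\<close>.\<close>
    define C where "C = (real k1 - 1) * (real k2 - 1) * suminf ?p + 1"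
    have "(\<Sum>n<m. nb_visit v n v) \<le> C" for m
    proof (rule tendsto_upperbound)
      show "((\<lambda>r. \<Sum>n<m. r ^ n * nb_visit v n v) \<longlongrightarrow> (\<Sum>n<m. nb_visit v n v)) (at_left 1)"
        by (auto intro!: tendsto_eq_intros)
      show "\<forall>\<^sub>F r in at_left 1. (\<Sum>n<m. r ^ n * nb_visit v n v) \<le> C"
        using eventually_at_left_field[of _ "1::real"]
      proof (rule iffD2, intro exI[of _ 0] conjI allI impI)
        fix r :: real assume r: "0 < r" "r < 1"
        define K where "K = (real k1 - 1) * (real k2 - 1)"
        have K: "1 < K" using k_bounds(3) by (simp add: K_def)
        have "source v r \<le> K / 1"
          unfolding source_def K_def[symmetric]
        proof (rule frac_le)
          show "1 \<le> real (codeg v) - 1 + r\<^sup>2"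
            using codeg_ge_2[OF v] zero_le_power2[of r] by linarith
        qed (use K in simp_all)
        then have le: "source v r * (ratio r ^ j * ?p j) \<le> K * ?p j" for j
          using ratio_bounds[OF v r] source_nonneg[OF v r] K
          by (intro mult_mono mult_left_le_one_le mult_nonneg_nonneg visit_nonneg)
            (simp_all add: power_le_one)
        have "green v r v \<le> K * suminf ?p"
          by (rule sums_le[OF le green_sums[OF v r] sums_mult[OF summable_sums[OF p]]])
        moreover have "(\<Sum>n<m. r ^ n * nb_visit v n v) \<le> green v r v + 1"
          using nb_visit_sums[OF v r v] nb_visit_nonneg r
            sum_le_suminf[of "\<lambda>n. r ^ n * nb_visit v n v" "{..<m}"]
          by (simp add: sums_iff)
        ultimately show "(\<Sum>n<m. r ^ n * nb_visit v n v) \<le> C" by (simp add: C_def K_def)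
      qed simp
    qed simp
    then show ?thesis by (intro summableI_nonneg_bounded nb_visit_nonneg)
  qed
  moreover have "summable ?p" if A: "summable (\<lambda>n. nb_visit v n v)"
  proof -
    \<comment> \<open>The limit of \<open>source v r\<close> as \<open>r\<close> tends to 1,
      positive by \<open>k_bounds\<close>.\<close>
    define c where "c = ((real k1 - 1) * (real k2 - 1) - 1) / real (codeg v)"
    have c: "0 < c" using k_bounds codeg_ge_2[OF v] by (simp add: c_def)
    have "c * (\<Sum>j\<le>m. ?p j) \<le> (\<Sum>n. nb_visit v n v)" for m
    proof (rule tendsto_upperbound)
      have "(source v \<longlongrightarrow> c) (at_left 1)"
        unfolding source_def[abs_def] c_def using codeg_ge_2[OF v]
        by (auto intro!: tendsto_eq_intros)
      moreover have "(ratio \<longlongrightarrow> 1) (at_left 1)"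
        unfolding ratio_def[abs_def] using k1 k2 by (auto intro!: tendsto_eq_intros)
      ultimately show "((\<lambda>r. source v r * (\<Sum>j\<le>m. ratio r ^ j * ?p j)) \<longlongrightarrow> c * (\<Sum>j\<le>m. ?p j)) (at_left 1)"
        by (auto intro!: tendsto_eq_intros)
      show "\<forall>\<^sub>F r in at_left 1. source v r * (\<Sum>j\<le>m. ratio r ^ j * ?p j) \<le> (\<Sum>n. nb_visit v n v)"
        using eventually_at_left_field[of _ "1::real"]
      proof (rule iffD2, intro exI[of _ 0] conjI allI impI)
        fix r :: real assume r: "0 < r" "r < 1"
        have "source v r * (\<Sum>j\<le>m. ratio r ^ j * ?p j) \<le> green v r v"
          unfolding sum_distrib_left sums_unique[OF green_sums[OF v r]]
          using green_sums[OF v r] source_nonneg[OF v r] ratio_bounds[OF v r]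
          by (intro sum_le_suminf) (auto simp: visit_nonneg sums_iff)
        also have "green v r v + 1 \<le> (\<Sum>n. nb_visit v n v)"
          using nb_visit_sums[OF v r v] r
          by (intro sums_le[OF _ _ summable_sums[OF A]])
            (auto simp: nb_visit_nonneg power_le_one mult_left_le_one_le)
        then have "green v r v \<le> (\<Sum>n. nb_visit v n v)" by simp
        finally show "source v r * (\<Sum>j\<le>m. ratio r ^ j * ?p j) \<le> (\<Sum>n. nb_visit v n v)" .
      qed simp
    qed simp
    then have "(\<Sum>j\<le>m. ?p j) \<le> (\<Sum>n. nb_visit v n v) / c" for m
      using c by (simp add: field_simps)
    then show ?thesis by (intro bounded_imp_summable visit_nonneg)
  qed
  ultimately show ?thesis by blast
qed

section \<open>Edge reversal and returns to a vertex\<close>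

lemma nbrw_visit_swap:
  "visit nbrw_nb {t} n s = visit nbrw_nb {prod.swap s} n (prod.swap t)"
proof (rule nbrw.visit_reversal[where r = prod.swap])
  fix s t assume t: "t \<in> nbrw_nb s"
  show "prod.swap s \<in> nbrw_nb (prod.swap t) \<and>
      card (nbrw_nb (prod.swap t)) = card (nbrw_nb s)"
  proof (cases "adj (fst s) (snd s)")
    case True
    \<comment> \<open>A step from \<open>(x, y)\<close> to \<open>(y, z)\<close> reverses to one
      from \<open>(z, y)\<close> to \<open>(y, x)\<close>; both starting edges end in
      \<open>y\<close> and so have equally many successors.\<close>
    then obtain x y z where s: "s = (x, y)" "adj x y" "t = (y, z)" "adj y z" "z \<noteq> x"
      using t by (cases s) (auto simp: nbrw_nb_def)
    then show ?thesis
      using card_nbrw_nb[of x y] card_nbrw_nb[of z y] adj_sym by (auto simp: nbrw_nb_def)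
  next
    case False
    then have "t = s" using t by (simp add: nbrw_nb_def)
    moreover have "\<not> adj (snd s) (fst s)" using False adj_sym by blast
    ultimately show ?thesis using False by (simp add: nbrw_nb_def)
  qed
qed (rule swap_swap)

text \<open>From \<open>(y, v)\<close> the next edge starts at \<open>v\<close>; so no edge out of
  \<open>v\<close> in \<open>n + 1\<close> steps means no visit to \<open>(y, v)\<close> in the
  first \<open>n\<close>.\<close>

lemma avoid_out_edges_Suc:
  "adj y v \<Longrightarrow> avoid nbrw_nb (out_edges v) (Suc n) s \<le> avoid nbrw_nb {(y, v)} n s"
proof (induction n arbitrary: s)
  case 0
  then show ?case using nbrw.avoid_le_1 by simp
next
  case (Suc n)
  have "indicat_real (- out_edges v) t * avoid nbrw_nb (out_edges v) (Suc n) t \<le>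
      indicat_real (- {(y, v)}) t * avoid nbrw_nb {(y, v)} n t" for t
  proof (cases "t = (y, v)")
    case True
    have "avoid nbrw_nb (out_edges v) (Suc n) (y, v) =
        avg nbrw_nb (\<lambda>_. 0) (y, v)"
      unfolding avoid_Suc using Suc.prems
      by (intro avg_cong) (auto simp: nbrw_nb_def out_edges_def indicator_def)
    with True show ?thesis by simp
  next
    case False
    then show ?thesis
      using Suc avoid_nonneg[of nbrw_nb "out_edges v" "Suc n" t]
        avoid_nonneg[of nbrw_nb "{(y, v)}" n t]
      by (auto simp: indicator_def)
  qed
  then show ?case
    unfolding avoid_Suc[of _ _ "Suc n"] avoid_Suc[of _ "{(y, v)}" n] by (intro avg_mono) auto
qed

text \<open>Some edge \<open>(v, y)\<close> is visited infinitely often in expectation, hence it is recurrent, and by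
  reversal so is \<open>(y, v)\<close>. The latter leads to all other edges out of \<open>v\<close>.\<close>

lemma avoid_out_edges_tendsto_0:
  assumes v: "v \<in> V" and inf: "\<not> summable (\<lambda>n. nb_visit v n v)"
    and e: "e \<in> out_edges v"
  shows "(\<lambda>n. avoid nbrw_nb (out_edges v) n e) \<longlonglongrightarrow> 0"
proof -
  obtain w where w: "adj v w" "\<not> summable (\<lambda>n. visit nbrw_nb (out_edges v) n (v, w))"
  proof -
    have "\<not> (\<forall>w\<in>nb v. summable (\<lambda>n. visit nbrw_nb (out_edges v) n (v, w)))"
      using inf unfolding nb_visit_def by (auto intro: summable_sum)
    then show thesis using that by blast
  qed
  \<comment> \<open>From an edge only edges are reached, so a visit to \<open>out_edges v\<close>
    splits into visits to the finitely many edges \<open>(v, z)\<close>.\<close>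
  have stay: "visit nbrw_nb (out_edges v) n (x, y) =
      (\<Sum>z\<in>nb v. visit nbrw_nb {(v, z)} n (x, y))" if "adj x y" for n x y
    using that
  proof (induction n arbitrary: x y)
    case 0
    then show ?case
      using finite_nb[OF v] by (auto simp: out_edges_def indicator_def if_distrib)
  next
    case (Suc n)
    have "avg nbrw_nb (visit nbrw_nb (out_edges v) n) (x, y) =
        avg nbrw_nb (\<lambda>t. \<Sum>z\<in>nb v. visit nbrw_nb {(v, z)} n t) (x, y)"
    proof (rule avg_cong)
      fix t assume "t \<in> nbrw_nb (x, y)"
      then obtain z where "t = (y, z)" "adj y z"
        using Suc.prems by (auto simp: nbrw_nb_def)
      then show "visit nbrw_nb (out_edges v) n t = (\<Sum>z\<in>nb v. visit nbrw_nb {(v, z)} n t)"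
        by (simp only: Suc.IH)
    qed
    then show ?case by (simp add: avg_sum)
  qed
  obtain y where y: "adj v y" "\<not> summable (\<lambda>n. visit nbrw_nb {(v, y)} n (v, w))"
  proof -
    have "\<not> (\<forall>y\<in>nb v. summable (\<lambda>n. visit nbrw_nb {(v, y)} n (v, w)))"
      using w(2) unfolding stay[OF w(1)] by (auto intro: summable_sum)
    then show thesis using that by blast
  qed
  have out: "(\<lambda>n. avoid nbrw_nb {(v, y)} n (v, y)) \<longlonglongrightarrow> 0"
    using y(2) by (rule nbrw.avoid_tendsto_0_if_not_summable)
  then have "\<not> summable (\<lambda>n. visit nbrw_nb {(v, y)} n (v, y))"
    by (rule nbrw.not_summable_if_avoid_tendsto_0)
  then have "\<not> summable (\<lambda>n. visit nbrw_nb {(y, v)} n (y, v))"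
    by (subst nbrw_visit_swap) simp
  then have rec: "(\<lambda>n. avoid nbrw_nb {(y, v)} n (y, v)) \<longlonglongrightarrow> 0"
    by (rule nbrw.avoid_tendsto_0_if_not_summable)
  have yv: "adj y v" using y(1) by (rule adj_sym)
  obtain z where e: "e = (v, z)" using e by (cases e) (simp add: out_edges_def)
  consider "\<not> adj v z" | "z = y" | "adj v z" "z \<noteq> y" by blast
  then show ?thesis
  proof cases
    \<comment> \<open>A pair that is not an edge stays put, so it returns to
      \<open>out_edges v\<close> at once.\<close>
    case 1
    have "avoid nbrw_nb (out_edges v) (Suc n) e = 0" for n
      using 1 by (simp add: avoid_Suc avg_def nbrw_nb_def e out_edges_def)
    then show ?thesis by (subst filterlim_sequentially_Suc[symmetric]) simp
  next
    case 2
    have "avoid nbrw_nb (out_edges v) n e \<le> avoid nbrw_nb {(v, y)} n (v, y)" for n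
      unfolding e 2 by (rule nbrw.avoid_antimono) (simp add: out_edges_def)
    then show ?thesis
      by (intro tendsto_sandwich[OF _ _ tendsto_const out]) (auto simp: avoid_nonneg)
  next
    case 3
    \<comment> \<open>Since \<open>(v, z)\<close> is one of \<open>k\<close> equally likely
      successors of \<open>(y, v)\<close>, its chance of missing \<open>(y, v)\<close> is at most
      \<open>k\<close> times that of \<open>(y, v)\<close> itself, with one more step.\<close>
    define k where "k = real (card (nbrw_nb (y, v)))"
    have t: "(v, z) \<in> nbrw_nb (y, v)" using 3 yv by (simp add: nbrw_nb_def)
    then have k: "k > 0" using nbrw.finite_N card_gt_0_iff by (fastforce simp: k_def)
    have le: "avoid nbrw_nb (out_edges v) (Suc n) e \<le> k * avoid nbrw_nb {(y, v)} (Suc n) (y, v)" for n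
    proof -
      have "avoid nbrw_nb (out_edges v) (Suc n) e \<le>
          indicat_real (- {(y, v)}) (v, z) * avoid nbrw_nb {(y, v)} n (v, z)"
        using avoid_out_edges_Suc[OF yv, of n e] yv adj_irrefl[of v] by (auto simp: e indicator_def)
      also have "\<dots> \<le> (\<Sum>t\<in>nbrw_nb (y, v). indicat_real (- {(y, v)}) t * avoid nbrw_nb {(y, v)} n t)"
        using t by (intro member_le_sum) (auto simp: avoid_nonneg)
      also have "\<dots> = k * avoid nbrw_nb {(y, v)} (Suc n) (y, v)"
        using k unfolding avoid_Suc avg_def by (simp add: k_def)
      finally show ?thesis .
    qed
    have "(\<lambda>n. k * avoid nbrw_nb {(y, v)} (Suc n) (y, v)) \<longlonglongrightarrow> 0"
      using rec by (intro tendsto_mult_right_zero) (rule LIMSEQ_Suc)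
    then have "(\<lambda>n. avoid nbrw_nb (out_edges v) (Suc n) e) \<longlonglongrightarrow> 0"
      by (rule Lim_null_comparison[rotated]) (use le in \<open>simp add: avoid_nonneg\<close>)
    then show ?thesis by (rule LIMSEQ_imp_Suc)
  qed
qed

section \<open>The walks as chains and the recurrence criteria\<close>

lemma walk_start:
  assumes "walk_process p v M X"
  shows "\<P>(\<omega> in M. X 0 \<omega> = x) = (if x = v then 1 else 0)"
proof -
  interpret prob_space M using assms by (simp add: walk_process_def)
  have [measurable]: "X 0 \<in> measurable M (count_space UNIV)"
    using assms by (simp add: walk_process_def)
  have AE: "AE \<omega> in M. X 0 \<omega> = v" using assms by (simp add: walk_process_def)
  show ?thesis
  proof (cases "x = v")
    case True
    with AE have "\<P>(\<omega> in M. X 0 \<omega> = x) = 1" by (subst prob_Collect_eq_1) auto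
    with True show ?thesis by simp
  next
    case False
    then have "AE \<omega> in M. X 0 \<omega> \<noteq> x" using AE by (auto elim!: eventually_mono)
    then have "\<P>(\<omega> in M. X 0 \<omega> = x) = 0" by (subst prob_eq_0) auto
    with False show ?thesis by simp
  qed
qed

text \<open>Product form of the conditional law; on a history of probability 0 both sides
  vanish.\<close>

lemma walk_step:
  assumes "walk_process p v M X"
  shows "\<P>(\<omega> in M. (\<forall>i\<le>n. X i \<omega> = x i) \<and> X (Suc n) \<omega> = y) =
    \<P>(\<omega> in M. \<forall>i\<le>n. X i \<omega> = x i) * p n x y"
proof -
  interpret prob_space M using assms by (simp add: walk_process_def)
  have [measurable]: "X n \<in> measurable M (count_space UNIV)" for n
    using assms by (simp add: walk_process_def)
  let ?H = "\<P>(\<omega> in M. \<forall>i\<le>n. X i \<omega> = x i)"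
  show ?thesis
  proof (cases "?H > 0")
    case True
    then have "\<P>(\<omega> in M. X (Suc n) \<omega> = y \<bar> \<forall>i\<le>n. X i \<omega> = x i) = p n x y"
      using assms by (simp add: walk_process_def)
    with True show ?thesis by (simp add: cond_prob_def field_simps conj_commute)
  next
    case False
    then have "?H = 0" by (simp add: zero_less_measure_iff)
    moreover have "\<P>(\<omega> in M. (\<forall>i\<le>n. X i \<omega> = x i) \<and> X (Suc n) \<omega> = y) \<le> ?H"
      by (rule finite_measure_mono) auto
    ultimately show ?thesis by (simp add: measure_le_0_iff)
  qed
qed

lemma walk_history_step:
  assumes W: "walk_process p v M X" and pos: "\<P>(\<omega> in M. \<forall>i\<le>Suc n. X i \<omega> = x i) > 0"
  shows "p n x (x (Suc n)) \<noteq> 0"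
proof
  assume 0: "p n x (x (Suc n)) = 0"
  have "(\<forall>i\<le>Suc n. X i \<omega> = x i) \<longleftrightarrow> (\<forall>i\<le>n. X i \<omega> = x i) \<and> X (Suc n) \<omega> = x (Suc n)" for \<omega>
    by (auto simp: le_Suc_eq)
  then have "\<P>(\<omega> in M. \<forall>i\<le>Suc n. X i \<omega> = x i) = 0"
    using walk_step[OF W, of n x "x (Suc n)"] 0 by simp
  with pos show False by simp
qed

lemma srw_chain:
  assumes v: "v \<in> V" and W: "walk_process (srw_step adj) v M X"
  shows "uniform_chain srw_nb M X {v}"
proof -
  interpret prob_space M using W by (simp add: walk_process_def)
  have [measurable]: "X n \<in> measurable M (count_space UNIV)" for n
    using W by (simp add: walk_process_def)
  show ?thesis
  proof
    fix n :: nat and x y assume y: "y \<in> srw_nb (x n)"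
    let ?H = "\<P>(\<omega> in M. \<forall>i\<le>n. X i \<omega> = x i)"
    show "\<P>(\<omega> in M. (\<forall>i\<le>n. X i \<omega> = x i) \<and> X (Suc n) \<omega> = y) = ?H / card (srw_nb (x n))"
    proof (cases "?H > 0")
      case True
      have "x n \<in> V"
      proof (cases n)
        case 0
        then show ?thesis using True walk_start[OF W, of "x 0"] v by (simp split: if_splits)
      next
        case (Suc m)
        then have "adj (x m) (x n)"
          using walk_history_step[OF W, of m x] True by (simp add: srw_step_def split: if_splits)
        then show ?thesis by (rule adj_V)
      qed
      with y show ?thesis
        unfolding walk_step[OF W] by (simp add: srw_nb_def srw_step_def card_nb)
    next
      case False
      then have "?H = 0" by (simp add: zero_less_measure_iff)
      then show ?thesis unfolding walk_step[OF W] by simp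
    qed
  qed (simp_all add: walk_start[OF W])
qed

lemma nbrw_chain:
  assumes v: "v \<in> V" and W: "walk_process (nbrw_step adj) v M X"
  shows "uniform_chain nbrw_nb M (\<lambda>n \<omega>. (X n \<omega>, X (Suc n) \<omega>)) (Pair v ` nb v)"
proof -
  interpret prob_space M using W by (simp add: walk_process_def)
  have [measurable]: "X n \<in> measurable M (count_space UNIV)" for n
    using W by (simp add: walk_process_def)
  show ?thesis
  proof
    show "{\<omega> \<in> space M. (X n \<omega>, X (Suc n) \<omega>) = s} \<in> sets M" for n s
      by (cases s) (simp, measurable)
    show "finite (Pair v ` nb v)" "Pair v ` nb v \<noteq> {}"
      using finite_nb[OF v] nb_nonempty[OF v] by auto
    fix s assume "s \<in> Pair v ` nb v"
    then obtain w where w: "s = (v, w)" "adj v w" by auto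
    have "\<P>(\<omega> in M. (\<forall>i\<le>0. X i \<omega> = v) \<and> X (Suc 0) \<omega> = w) = 1 / deg adj v"
      unfolding walk_step[OF W, of 0 "\<lambda>_. v" w] using w(2) walk_start[OF W, of v]
      by (simp add: nbrw_step_def)
    then show "\<P>(\<omega> in M. (X 0 \<omega>, X (Suc 0) \<omega>) = s) = 1 / card (Pair v ` nb v)"
      using w(1) by (simp add: card_image inj_on_def card_nb)
  next
    fix n :: nat and y :: "nat \<Rightarrow> 'a \<times> 'a" and t assume t: "t \<in> nbrw_nb (y n)"
    let ?Y = "\<lambda>n \<omega>. (X n \<omega>, X (Suc n) \<omega>)"
    \<comment> \<open>The vertex path read off from \<open>y\<close>: the first entry of the first
      pair, then all second entries.\<close>
    define x where "x i = (case i of 0 \<Rightarrow> fst (y 0) | Suc j \<Rightarrow> snd (y j))" for i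
    show "\<P>(\<omega> in M. (\<forall>i\<le>n. ?Y i \<omega> = y i) \<and> ?Y (Suc n) \<omega> = t) =
        \<P>(\<omega> in M. \<forall>i\<le>n. ?Y i \<omega> = y i) / card (nbrw_nb (y n))"
    proof (cases "\<forall>i\<le>n. y i = (x i, x (Suc i))")
      case False
      \<comment> \<open>If consecutive pairs of \<open>y\<close> do not fit together, no trajectory
        has this history and both probabilities are 0.\<close>
      have "\<not> (\<forall>i\<le>n. ?Y i \<omega> = y i)" for \<omega>
      proof
        assume *: "\<forall>i\<le>n. ?Y i \<omega> = y i"
        have "y i = (x i, x (Suc i))" if "i \<le> n" for i
        proof (cases i)
          case 0
          then show ?thesis by (simp add: x_def)
        next
          case (Suc j)
          then have "?Y j \<omega> = y j" "?Y i \<omega> = y i" using * that by auto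
          then show ?thesis using Suc by (auto simp: x_def prod_eq_iff)
        qed
        with False show False by blast
      qed
      then have "{\<omega> \<in> space M. (\<forall>i\<le>n. ?Y i \<omega> = y i) \<and> Q \<omega>} = {}" for Q by blast
      from this[of "\<lambda>\<omega>. ?Y (Suc n) \<omega> = t"] this[of "\<lambda>_. True"]
      show ?thesis by (simp only: simp_thms measure_empty div_0)
    next
      case True
      then have yn: "y n = (x n, x (Suc n))" by simp
      \<comment> \<open>Pairs up to time \<open>n\<close> involve vertices up to time
        \<open>Suc n\<close>.\<close>
      have hist: "(\<forall>i\<le>n. ?Y i \<omega> = y i) \<longleftrightarrow> (\<forall>i\<le>Suc n. X i \<omega> = x i)" for \<omega>
      proof -
        have "(\<forall>i\<le>n. ?Y i \<omega> = y i) \<longleftrightarrow> (\<forall>i\<le>n. X i \<omega> = x i \<and> X (Suc i) \<omega> = x (Suc i))"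
          using True by auto
        also have "\<dots> \<longleftrightarrow> (\<forall>i\<le>Suc n. X i \<omega> = x i)"
          by (metis Suc_le_mono le_SucE le_SucI le0 order_refl)
        finally show ?thesis .
      qed
      let ?H = "\<P>(\<omega> in M. \<forall>i\<le>Suc n. X i \<omega> = x i)"
      show ?thesis
      proof (cases "?H > 0")
        case True
        have a: "adj (x n) (x (Suc n))"
          using walk_history_step[OF W True] by (auto simp: nbrw_step_def split: if_splits)
        then obtain z where z: "t = (x (Suc n), z)" "adj (x (Suc n)) z" "z \<noteq> x n"
          using t yn by (auto simp: nbrw_nb_def)
        have "(\<forall>i\<le>n. ?Y i \<omega> = y i) \<and> ?Y (Suc n) \<omega> = t \<longleftrightarrow>
            (\<forall>i\<le>Suc n. X i \<omega> = x i) \<and> X (Suc (Suc n)) \<omega> = z" for \<omega>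
          unfolding hist z(1) by auto
        then have "\<P>(\<omega> in M. (\<forall>i\<le>n. ?Y i \<omega> = y i) \<and> ?Y (Suc n) \<omega> = t) =
            ?H * nbrw_step adj (Suc n) x z"
          using walk_step[OF W, of "Suc n" x z] by (simp only:)
        also have "\<dots> = ?H / card (nbrw_nb (y n))"
          using z deg_ge_2[of "x (Suc n)"] adj_V(2)[OF a]
          by (simp add: nbrw_step_def yn card_nbrw_nb[OF a] of_nat_diff)
        finally show ?thesis unfolding hist .
      next
        case False
        then have H: "?H = 0" by (simp add: zero_less_measure_iff)
        have "\<P>(\<omega> in M. (\<forall>i\<le>Suc n. X i \<omega> = x i) \<and> ?Y (Suc n) \<omega> = t) \<le> ?H"
          by (rule finite_measure_mono) auto
        then show ?thesis unfolding hist using H by (simp add: measure_le_0_iff)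
      qed
    qed
  qed
qed

text \<open>If the series converges, Borel-Cantelli gives finitely many visits almost surely, which
  contradicts recurrence on the walk from \<open>srw_exists\<close>. If it diverges,
  \<open>avoid\<close> tends to 0.\<close>

lemma srw_recurrent_iff:
  "srw_recurrent V adj \<longleftrightarrow> (\<forall>v\<in>V. \<not> summable (\<lambda>n. visit srw_nb {v} n v))"
proof (intro iffI ballI)
  fix v assume R: "srw_recurrent V adj" and v: "v \<in> V"
  obtain M :: "(nat \<Rightarrow> 'a) measure" and X where W: "walk_process (srw_step adj) v M X"
    using srw_exists[OF graph _ v] deg_ge_2 by fastforce
  then interpret uniform_chain srw_nb M X "{v}" by (rule srw_chain[OF v])
  have inf: "AE \<omega> in M. infinite {n. X n \<omega> = v}"
    using R v W unfolding srw_recurrent_def recurrent_walk_def by blast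
  show "\<not> summable (\<lambda>n. visit srw_nb {v} n v)"
  proof
    assume "summable (\<lambda>n. visit srw_nb {v} n v)"
    then have "AE \<omega> in M. finite {n. X n \<omega> \<in> {v}}"
      by (intro AE_finite_visits) (auto simp: meas)
    with inf have "AE \<omega> in M. False" by eventually_elim simp
    then show False by simp
  qed
next
  assume S: "\<forall>v\<in>V. \<not> summable (\<lambda>n. visit srw_nb {v} n v)"
  show "srw_recurrent V adj"
    unfolding srw_recurrent_def recurrent_walk_def
  proof (intro ballI allI impI)
    fix v and M :: "(nat \<Rightarrow> 'a) measure" and X
    assume v: "v \<in> V" and W: "walk_process (srw_step adj) v M X"
    interpret uniform_chain srw_nb M X "{v}" using v W by (rule srw_chain)
    have "(\<lambda>n. avoid srw_nb {v} n v) \<longlonglongrightarrow> 0"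
      using S v by (intro srw.avoid_tendsto_0_if_not_summable) blast
    then have "AE \<omega> in M. infinite {n. X n \<omega> \<in> {v}}"
      by (intro AE_infinite_visits) (auto simp: meas)
    then show "AE \<omega> in M. infinite {n. X n \<omega> = v}" by simp
  qed
qed

text \<open>The same argument for the chain of edges, started from a uniform edge out of
  \<open>v\<close>; visits of the walk to \<open>v\<close> are visits of this chain to
  \<open>out_edges v\<close>.\<close>

lemma nbrw_recurrent_iff:
  "nbrw_recurrent V adj \<longleftrightarrow> (\<forall>v\<in>V. \<not> summable (\<lambda>n. nb_visit v n v))"
proof (intro iffI ballI)
  fix v assume R: "nbrw_recurrent V adj" and v: "v \<in> V"
  obtain M :: "(nat \<Rightarrow> 'a) measure" and X where W: "walk_process (nbrw_step adj) v M X"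
    using nbrw_exists[OF graph _ v] deg_ge_2 by fastforce
  then interpret uniform_chain nbrw_nb M "\<lambda>n \<omega>. (X n \<omega>, X (Suc n) \<omega>)" "Pair v ` nb v"
    by (rule nbrw_chain[OF v])
  have [measurable]: "X n \<in> measurable M (count_space UNIV)" for n
    using W by (simp add: walk_process_def)
  have inf: "AE \<omega> in M. infinite {n. X n \<omega> = v}"
    using R v W unfolding nbrw_recurrent_def recurrent_walk_def by blast
  show "\<not> summable (\<lambda>n. nb_visit v n v)"
  proof
    assume A: "summable (\<lambda>n. nb_visit v n v)"
    have "AE \<omega> in M. finite {n. (X n \<omega>, X (Suc n) \<omega>) \<in> out_edges v}"
    proof (rule AE_finite_visits)
      show "{\<omega> \<in> space M. (X n \<omega>, X (Suc n) \<omega>) \<in> out_edges v} \<in> sets M" for n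
        by (simp add: out_edges_def)
      fix s assume "s \<in> Pair v ` nb v"
      then obtain w where w: "s = (v, w)" "adj v w" by auto
      show "summable (\<lambda>n. visit nbrw_nb (out_edges v) n s)"
      proof (rule summable_comparison_test'[OF A])
        fix n
        have "visit nbrw_nb (out_edges v) n s \<le> nb_visit v n v"
          unfolding nb_visit_def w(1) using w(2) finite_nb[OF v]
          by (intro member_le_sum) (auto simp: visit_nonneg)
        then show "norm (visit nbrw_nb (out_edges v) n s) \<le> nb_visit v n v"
          by (simp add: visit_nonneg)
      qed
    qed
    with inf have "AE \<omega> in M. False" by eventually_elim (simp add: out_edges_def)
    then show False by simp
  qed
next
  assume S: "\<forall>v\<in>V. \<not> summable (\<lambda>n. nb_visit v n v)"
  show "nbrw_recurrent V adj"
    unfolding nbrw_recurrent_def recurrent_walk_def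
  proof (intro ballI allI impI)
    fix v and M :: "(nat \<Rightarrow> 'a) measure" and X
    assume v: "v \<in> V" and W: "walk_process (nbrw_step adj) v M X"
    interpret uniform_chain nbrw_nb M "\<lambda>n \<omega>. (X n \<omega>, X (Suc n) \<omega>)" "Pair v ` nb v"
      using v W by (rule nbrw_chain)
    have [measurable]: "X n \<in> measurable M (count_space UNIV)" for n
      using W by (simp add: walk_process_def)
    have "AE \<omega> in M. infinite {n. (X n \<omega>, X (Suc n) \<omega>) \<in> out_edges v}"
    proof (rule AE_infinite_visits)
      show "{\<omega> \<in> space M. (X n \<omega>, X (Suc n) \<omega>) \<in> out_edges v} \<in> sets M" for n
        by (simp add: out_edges_def)
      show "Pair v ` nb v \<subseteq> out_edges v" by (auto simp: out_edges_def)
    qed (use S v in \<open>simp add: avoid_out_edges_tendsto_0\<close>)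
    then show "AE \<omega> in M. infinite {n. X n \<omega> = v}" by (simp add: out_edges_def)
  qed
qed

end

theorem proposition1:
  fixes V :: "'a set" and adj :: "'a \<Rightarrow> 'a \<Rightarrow> bool" and k1 k2 :: nat
  assumes "k1 > k2" and "k2 \<ge> 2"
    and "simple_graph V adj" and "infinite V"
    and "\<forall>x\<in>V. deg adj x = k1 \<or> deg adj x = k2"
    and "\<forall>x y. adj x y \<and> deg adj x = k1 \<longrightarrow> deg adj y = k2"
    and "\<forall>x y. adj x y \<and> deg adj x = k2 \<longrightarrow> deg adj y = k1"
  shows "nbrw_recurrent V adj \<longleftrightarrow> srw_recurrent V adj"
proof -
  interpret biregular_graph V adj k1 k2
  proof
    show "2 \<le> k1" "2 \<le> k2" "k1 \<noteq> k2" using assms(1,2) by simp_all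
    show "simple_graph V adj" by (rule assms(3))
  qed (use assms(5-7) in blast)+
  \<comment> \<open>Both recurrences mean that a series diverges at every vertex, and the series are
    matched vertex by vertex.\<close>
  show ?thesis
    by (simp add: nbrw_recurrent_iff srw_recurrent_iff summable_nb_visit_iff)
qed

end
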